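(* Let $t,d$ be positive integers. For any finite measure $\mu$ on $\mathbb{R}^d$ that is absolutely continuous with respect to the Lebesgue measure, there exists a convex partition of $\mathbb{R}^d$ into $(t+1)2^{d-1}$ regions, all of equal $\mu$-measure, such that every hyperplane in $\mathbb{R}^d$ avoids the interior of at least $t$ of the regions.
   Context: A convex partition of $\mathbb{R}^d$ is a finite family of closed convex subsets of $\mathbb{R}^d$ whose union is $\mathbb{R}^d$ and whose interiors are pairwise disjoint. A hyperplane avoids (misses) the interior of a region if it does not intersect the interior of that region. *)

theory Defs
  imports "HOL-Analysis.Analysis"
begin

definition convex_partition :: "'a::euclidean_space set set \<Rightarrow> bool" where
  "convex_partition P \<longleftrightarrow>
     finite P \<and> (\<forall>C\<in>P. closed C \<and> convex C) \<and> \<Union>P = UNIV \<and> disjoint_family_on interior P"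

definition hyperplane :: "'a::euclidean_space set \<Rightarrow> bool" where
  "hyperplane H \<longleftrightarrow> (\<exists>a b. a \<noteq> 0 \<and> H = {x. a \<bullet> x = b})"

definition avoids_interior :: "'a::euclidean_space set \<Rightarrow> 'a set \<Rightarrow> bool" where
  "avoids_interior H C \<longleftrightarrow> H \<inter> interior C = {}"

end

theory Submission
  imports Defs "HOL-Complex_Analysis.Great_Picard"
begin

text \<open>
  Let first \<open>\<mu>\<close> charge every nonempty open set. Yao-Yao fans are built one coordinate at a time: a
  level consists of \<open>2 ^ m\<close> cylindrical cells with a \<open>2 ^ m\<close>-dimensional space \<open>L\<close> of cellwise affine
  functions, and a function \<open>g \<in> L\<close>, read as a cut in the direction of the next coordinate \<open>y\<close>,
  doubles every cell; the new space consists of the functions \<open>\<psi> + \<kappa> (y - g)\<close> with \<open>\<psi> \<in> L\<close> and one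
  slope \<open>\<kappa>\<close> per old cell. An element of \<open>L\<close> that is nonnegative at the centre of the fan is
  nonnegative on a whole cell. This comparison property makes the hyperplane count work. Some
  element of \<open>L\<close> cuts off a prescribed mass from every cell: eliminating one slope at a time, the
  problem reduces to the intermediate value theorem for a single real unknown.

  Halving \<open>d - 1\<close> times and then cutting \<open>t\<close> times successively in the last direction gives
  \<open>(t + 1) 2 ^ (d - 1)\<close> regions. A hyperplane not containing the last direction is the graph of an
  element \<open>h \<in> L\<close>; comparing \<open>h\<close> with each cut gives \<open>t\<close> distinct missed regions. Other
  hyperplanes miss a whole cell and thus \<open>t + 1\<close> regions.

  A general \<open>\<mu>\<close> is perturbed to \<open>\<mu> + \<nu> / n\<close> with \<open>\<nu>\<close> positive on open sets; along a subsequence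
  the regions converge, and all the required properties pass to the limit by convexity.
\<close>

section \<open>Threshold functionals\<close>

text \<open>Encoding an affine function as the pair of its gradient and its constant places it in a
  normed vector space, where subspaces and continuity in the function make sense.\<close>

definition aff :: "'a::euclidean_space \<times> real \<Rightarrow> 'a \<Rightarrow> real" where
  "aff p x = fst p \<bullet> x + snd p"

lemma aff_add: "aff (p + q) x = aff p x + aff q x"
  and aff_diff: "aff (p - q) x = aff p x - aff q x"
  and aff_scaleR: "aff (r *\<^sub>R p) x = r * aff p x"
  by (simp_all add: aff_def inner_add_left inner_diff_left algebra_simps)

lemmas aff_simps = aff_add aff_diff aff_scaleR

lemma continuous_on_aff [continuous_intros]: "continuous_on A (aff p)"
  unfolding aff_def by (intro continuous_intros)

text \<open>The functionals to be annihilated, one per cell \<open>U\<close>: how far the part of the cell's mass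
  lying below the graph of \<open>p\<close> exceeds its target. Strictness may fail below zero, because the
  graph can then run entirely below the support of the mass.\<close>

definition threshold ::
  "('a::euclidean_space \<times> real) set \<Rightarrow> 'a set \<Rightarrow> ('a \<times> real \<Rightarrow> real) \<Rightarrow> bool" where
  "threshold S U T \<longleftrightarrow> continuous_on S T
     \<and> (\<forall>p\<in>S. \<forall>q\<in>S. (\<forall>x\<in>U. aff p x \<le> aff q x) \<longrightarrow> T p \<le> T q)
     \<and> (\<forall>p\<in>S. \<forall>q\<in>S. (\<forall>x\<in>U. aff p x < aff q x) \<longrightarrow> 0 \<le> T q \<longrightarrow> T p < T q)
     \<and> (\<forall>p\<in>S. \<forall>e\<in>S. (\<forall>x\<in>U. 0 < aff e x) \<longrightarrow>
          (\<exists>r. 0 < T (p + r *\<^sub>R e)) \<and> (\<exists>r. T (p + r *\<^sub>R e) < 0))"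

lemma thresholdD:
  assumes "threshold S U T"
  shows threshold_continuous: "continuous_on S T"
    and threshold_mono: "\<And>p q. p \<in> S \<Longrightarrow> q \<in> S \<Longrightarrow> (\<And>x. x \<in> U \<Longrightarrow> aff p x \<le> aff q x) \<Longrightarrow> T p \<le> T q"
    and threshold_strict: "\<And>p q. p \<in> S \<Longrightarrow> q \<in> S \<Longrightarrow> (\<And>x. x \<in> U \<Longrightarrow> aff p x < aff q x) \<Longrightarrow> 0 \<le> T q \<Longrightarrow> T p < T q"
    and threshold_pos: "\<And>p e. p \<in> S \<Longrightarrow> e \<in> S \<Longrightarrow> (\<And>x. x \<in> U \<Longrightarrow> 0 < aff e x) \<Longrightarrow> \<exists>r. 0 < T (p + r *\<^sub>R e)"
    and threshold_neg: "\<And>p e. p \<in> S \<Longrightarrow> e \<in> S \<Longrightarrow> (\<And>x. x \<in> U \<Longrightarrow> 0 < aff e x) \<Longrightarrow> \<exists>r. T (p + r *\<^sub>R e) < 0"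
  using assms unfolding threshold_def by blast+

lemma threshold_subset:
  assumes "threshold S U T" "S' \<subseteq> S"
  shows "threshold S' U T"
  using assms continuous_on_subset unfolding threshold_def by (meson subsetD)

text \<open>The intermediate value theorem on the line through \<open>p\<close> in direction
  \<open>e\<close>: positivity of \<open>e\<close> makes \<open>T\<close> monotone along it, which
  orders the two points of opposite sign.\<close>

lemma threshold_root:
  assumes S: "subspace S" and T: "threshold S U T" and p: "p \<in> S" and e: "e \<in> S"
    and pos: "\<And>x. x \<in> U \<Longrightarrow> 0 < aff e x"
  shows "\<exists>r. T (p + r *\<^sub>R e) = 0"
proof -
  have mem: "p + r *\<^sub>R e \<in> S" for r
    using S p e by (simp add: subspace_add subspace_scale)
  obtain r1 where r1: "0 < T (p + r1 *\<^sub>R e)" using threshold_pos[OF T p e] pos by blast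
  obtain r2 where r2: "T (p + r2 *\<^sub>R e) < 0" using threshold_neg[OF T p e] pos by blast
  have "r2 \<le> r1"
  proof (rule ccontr)
    assume "\<not> r2 \<le> r1"
    then have "T (p + r1 *\<^sub>R e) \<le> T (p + r2 *\<^sub>R e)"
      by (intro threshold_mono[OF T mem mem]) (auto simp: aff_simps intro!: mult_right_mono intro: less_imp_le pos)
    then show False using r1 r2 by simp
  qed
  moreover have "continuous_on {r2..r1} (\<lambda>r. T (p + r *\<^sub>R e))"
    by (rule continuous_on_compose2[OF threshold_continuous[OF T]]) (auto intro!: continuous_intros mem)
  ultimately show ?thesis
    using IVT'[of "\<lambda>r. T (p + r *\<^sub>R e)" r2 0 r1] r1 r2 by auto
qed

text \<open>Eliminating the slope along \<open>e\<close>: it is determined by the cell where \<open>e > 0\<close>, and it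
  decreases when \<open>p\<close> increases, so on the cell where \<open>e < 0\<close> both contributions increase.\<close>

lemma threshold_eliminate:
  assumes S: "subspace S" and e: "e \<in> S"
    and T1: "threshold S U1 T1" and T2: "threshold S U2 T2"
    and pos: "\<And>x. x \<in> U1 \<Longrightarrow> 0 < aff e x" and neg: "\<And>x. x \<in> U2 \<Longrightarrow> aff e x < 0"
    and U: "U1 \<subseteq> U" "U2 \<subseteq> U"
  obtains \<kappa> where "\<And>p. p \<in> S \<Longrightarrow> T1 (p + \<kappa> p *\<^sub>R e) = 0"
    and "threshold S U (\<lambda>p. T2 (p + \<kappa> p *\<^sub>R e))"
proof -
  have mem: "p + r *\<^sub>R e \<in> S" if "p \<in> S" for p r
    using S that e by (simp add: subspace_add subspace_scale)
  obtain \<kappa> where \<kappa>: "\<And>p. p \<in> S \<Longrightarrow> T1 (p + \<kappa> p *\<^sub>R e) = 0"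
    using threshold_root[OF S T1 _ e] pos by metis
  have mono1: "T1 (p + r *\<^sub>R e) \<le> T1 (p + s *\<^sub>R e)" if "p \<in> S" "r \<le> s" for p r s
    using that by (intro threshold_mono[OF T1 mem mem])
      (auto simp: aff_simps intro!: mult_right_mono intro: less_imp_le pos)
  have strict1: "T1 (p + r *\<^sub>R e) < T1 (p + s *\<^sub>R e)" if "p \<in> S" "r < s" "0 \<le> T1 (p + s *\<^sub>R e)" for p r s
    using that by (intro threshold_strict[OF T1 mem mem])
      (auto simp: aff_simps intro!: mult_strict_right_mono pos)
  have anti: "\<kappa> q \<le> \<kappa> p" if pq: "p \<in> S" "q \<in> S" and le: "\<And>x. x \<in> U \<Longrightarrow> aff p x \<le> aff q x" for p q
  proof (rule ccontr)
    \<comment> \<open>Strictness is available here because the larger of the two values is the root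
      value 0.\<close>
    assume "\<not> \<kappa> q \<le> \<kappa> p"
    then have "T1 (q + \<kappa> p *\<^sub>R e) < T1 (q + \<kappa> q *\<^sub>R e)"
      using strict1[OF pq(2), of "\<kappa> p" "\<kappa> q"] \<kappa>[OF pq(2)] by simp
    moreover have "T1 (p + \<kappa> p *\<^sub>R e) \<le> T1 (q + \<kappa> p *\<^sub>R e)"
      using pq U le by (intro threshold_mono[OF T1 mem mem]) (auto simp: aff_simps)
    ultimately show False using \<kappa> pq by simp
  qed
  have cont1: "continuous_on S (\<lambda>p. T1 (p + r *\<^sub>R e))" for r
    by (rule continuous_on_compose2[OF threshold_continuous[OF T1]]) (auto intro!: continuous_intros mem)
  then have lim1: "((\<lambda>q. T1 (q + r *\<^sub>R e)) \<longlongrightarrow> T1 (p + r *\<^sub>R e)) (at p within S)" if "p \<in> S" for p r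
    using that by (simp add: continuous_on_def)
  \<comment> \<open>For fixed \<open>a\<close>, the sign of \<open>T1\<close> at slope
    \<open>a\<close> tells on which side of \<open>a\<close> the root lies. A strict sign persists
    for nearby \<open>q\<close>, so strict bounds on \<kappa> persist too.\<close>
  have "continuous_on S \<kappa>"
    unfolding continuous_on_def
  proof (intro ballI order_tendstoI)
    fix p a assume p: "p \<in> S" and a: "a < \<kappa> p"
    have "T1 (p + a *\<^sub>R e) < 0" using strict1[OF p a] \<kappa>[OF p] by simp
    then have "eventually (\<lambda>q. T1 (q + a *\<^sub>R e) < 0) (at p within S)"
      by (rule order_tendstoD(2)[OF lim1[OF p]])
    then show "eventually (\<lambda>q. a < \<kappa> q) (at p within S)"
      unfolding eventually_at_filter
    proof eventually_elim
      case (elim q)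
      show ?case
      proof (intro impI, rule ccontr)
        assume "q \<noteq> p" "q \<in> S" "\<not> a < \<kappa> q"
        then show False using elim mono1[of q "\<kappa> q" a] \<kappa>[of q] by auto
      qed
    qed
  next
    fix p a assume p: "p \<in> S" and a: "\<kappa> p < a"
    have "0 \<le> T1 (p + a *\<^sub>R e)" using mono1[OF p, of "\<kappa> p" a] \<kappa>[OF p] a by simp
    then have "0 < T1 (p + a *\<^sub>R e)" using strict1[OF p a] \<kappa>[OF p] by simp
    then have "eventually (\<lambda>q. 0 < T1 (q + a *\<^sub>R e)) (at p within S)"
      by (rule order_tendstoD(1)[OF lim1[OF p]])
    then show "eventually (\<lambda>q. \<kappa> q < a) (at p within S)"
      unfolding eventually_at_filter
    proof eventually_elim
      case (elim q)
      show ?case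
      proof (intro impI, rule ccontr)
        assume "q \<noteq> p" "q \<in> S" "\<not> \<kappa> q < a"
        then show False using elim mono1[of q a "\<kappa> q"] \<kappa>[of q] by auto
      qed
    qed
  qed
  then have "continuous_on S (\<lambda>p. T2 (p + \<kappa> p *\<^sub>R e))"
    by (intro continuous_on_compose2[OF threshold_continuous[OF T2]]) (auto intro!: continuous_intros mem)
  moreover have "T2 (p + \<kappa> p *\<^sub>R e) \<le> T2 (q + \<kappa> q *\<^sub>R e)"
    if pq: "p \<in> S" "q \<in> S" and le: "\<forall>x\<in>U. aff p x \<le> aff q x" for p q
  proof (rule threshold_mono[OF T2 mem[OF pq(1)] mem[OF pq(2)]])
    fix x assume x: "x \<in> U2"
    have "\<kappa> p * aff e x \<le> \<kappa> q * aff e x"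
      using le neg[OF x] by (intro mult_right_mono_neg anti[OF pq]) auto
    moreover have "aff p x \<le> aff q x" using x U le by auto
    ultimately show "aff (p + \<kappa> p *\<^sub>R e) x \<le> aff (q + \<kappa> q *\<^sub>R e) x" by (simp add: aff_simps)
  qed
  moreover have "T2 (p + \<kappa> p *\<^sub>R e) < T2 (q + \<kappa> q *\<^sub>R e)"
    if pq: "p \<in> S" "q \<in> S" and less: "\<forall>x\<in>U. aff p x < aff q x" and q: "0 \<le> T2 (q + \<kappa> q *\<^sub>R e)" for p q
  proof (rule threshold_strict[OF T2 mem[OF pq(1)] mem[OF pq(2)] _ q])
    fix x assume x: "x \<in> U2"
    have "\<kappa> p * aff e x \<le> \<kappa> q * aff e x"
      using less neg[OF x] by (intro mult_right_mono_neg anti[OF pq]) (auto intro: less_imp_le)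
    moreover have "aff p x < aff q x" using x U less by auto
    ultimately show "aff (p + \<kappa> p *\<^sub>R e) x < aff (q + \<kappa> q *\<^sub>R e) x" by (simp add: aff_simps)
  qed
  moreover have "(\<exists>r. 0 < T2 (p + r *\<^sub>R f + \<kappa> (p + r *\<^sub>R f) *\<^sub>R e)) \<and>
      (\<exists>r. T2 (p + r *\<^sub>R f + \<kappa> (p + r *\<^sub>R f) *\<^sub>R e) < 0)"
    if pf: "p \<in> S" "f \<in> S" and f: "\<forall>x\<in>U. 0 < aff f x" for p f
  proof
    have memf: "p + r *\<^sub>R f \<in> S" for r
      using S pf by (simp add: subspace_add subspace_scale)
    have mono2: "T2 (p + r *\<^sub>R f + a *\<^sub>R e) \<le> T2 (p + s *\<^sub>R f + b *\<^sub>R e)" if "r \<le> s" "b \<le> a" for r s a b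
    proof (rule threshold_mono[OF T2 mem[OF memf] mem[OF memf]])
      fix x assume x: "x \<in> U2"
      have "r * aff f x \<le> s * aff f x"
        using that x U f by (intro mult_right_mono) (auto intro: less_imp_le)
      moreover have "a * aff e x \<le> b * aff e x"
        using that neg[OF x] by (intro mult_right_mono_neg) auto
      ultimately show "aff (p + r *\<^sub>R f + a *\<^sub>R e) x \<le> aff (p + s *\<^sub>R f + b *\<^sub>R e) x"
        by (simp add: aff_simps)
    qed
    have comm: "p + a *\<^sub>R e + r *\<^sub>R f = p + r *\<^sub>R f + a *\<^sub>R e" for a r by simp
    have anti': "\<kappa> (p + s *\<^sub>R f) \<le> \<kappa> (p + r *\<^sub>R f)" if "r \<le> s" for r s
      using that f by (intro anti memf) (auto simp: aff_simps intro!: mult_right_mono intro: less_imp_le)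
    \<comment> \<open>With the slope frozen at \<open>\<kappa> p\<close>, \<open>T2\<close> itself
      supplies \<open>r\<close>. Passing to \<open>max r 0\<close> makes the true slope at most
      \<open>\<kappa> p\<close>, and lowering the slope cannot lower \<open>T2\<close> because
      \<open>e\<close> is negative on \<open>U2\<close>. The negative sign is symmetric, with
      \<open>min r 0\<close>.\<close>
    obtain r where r: "0 < T2 (p + r *\<^sub>R f + \<kappa> p *\<^sub>R e)"
      using threshold_pos[OF T2 mem[OF pf(1), of "\<kappa> p"] pf(2)] f U unfolding comm by blast
    have "0 < T2 (p + max r 0 *\<^sub>R f + \<kappa> (p + max r 0 *\<^sub>R f) *\<^sub>R e)"
      using r mono2[of r "max r 0" "\<kappa> (p + max r 0 *\<^sub>R f)" "\<kappa> p"] anti'[of 0 "max r 0"] by simp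
    then show "\<exists>r. 0 < T2 (p + r *\<^sub>R f + \<kappa> (p + r *\<^sub>R f) *\<^sub>R e)" by blast
    obtain r where r: "T2 (p + r *\<^sub>R f + \<kappa> p *\<^sub>R e) < 0"
      using threshold_neg[OF T2 mem[OF pf(1), of "\<kappa> p"] pf(2)] f U unfolding comm by blast
    have "T2 (p + min r 0 *\<^sub>R f + \<kappa> (p + min r 0 *\<^sub>R f) *\<^sub>R e) < 0"
      using r mono2[of "min r 0" r "\<kappa> p" "\<kappa> (p + min r 0 *\<^sub>R f)"] anti'[of "min r 0" 0] by simp
    then show "\<exists>r. T2 (p + r *\<^sub>R f + \<kappa> (p + r *\<^sub>R f) *\<^sub>R e) < 0" by blast
  qed
  ultimately have "threshold S U (\<lambda>p. T2 (p + \<kappa> p *\<^sub>R e))"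
    unfolding threshold_def by blast
  with \<kappa> show thesis by (rule that)
qed

section \<open>Yao-Yao fans\<close>

text \<open>An enumeration of the standard basis, so that coordinates can be added one at a
  time.\<close>

locale coordinate_frame =
  fixes b :: "nat \<Rightarrow> 'a::euclidean_space"
  assumes bij: "bij_betw b {..<DIM('a)} Basis"
begin

lemma inner_frame: "i < DIM('a) \<Longrightarrow> j < DIM('a) \<Longrightarrow> b i \<bullet> b j = (if i = j then 1 else 0)"
  using bij bij_betw_apply[OF bij] by (auto simp: bij_betw_def inj_on_def inner_Basis)

text \<open>The affine functions of the first \<open>m\<close> coordinates alone; any of them can
  serve as a graph in the direction of a later coordinate.\<close>

definition initial_affine :: "nat \<Rightarrow> ('a \<times> real) set" where
  "initial_affine m = {p. \<forall>k. m \<le> k \<longrightarrow> k < DIM('a) \<longrightarrow> fst p \<bullet> b k = 0}"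

lemma subspace_initial_affine: "subspace (initial_affine m)"
  by (auto simp: initial_affine_def subspace_def inner_add_left)

lemma initial_affine_mono: "m \<le> n \<Longrightarrow> initial_affine m \<subseteq> initial_affine n"
  by (auto simp: initial_affine_def)

lemma aff_shift: "p \<in> initial_affine m \<Longrightarrow> m \<le> k \<Longrightarrow> k < DIM('a) \<Longrightarrow> aff p (x + r *\<^sub>R b k) = aff p x"
  by (auto simp: initial_affine_def aff_def inner_add_right)

text \<open>A fan of \<open>2 ^ m\<close> open cells, cylinders over the first \<open>m\<close> coordinates, with a
  \<open>2 ^ m\<close>-dimensional space \<open>L\<close> of functions that are affine on each cell (and need not be
  continuous across cells). The last-added coordinate is the head of the index list; indices of the
  wrong length are junk.\<close>

inductive yao_yao :: "nat \<Rightarrow> (bool list \<Rightarrow> 'a set) \<Rightarrow> (bool list \<Rightarrow> 'a \<times> real) set \<Rightarrow> bool" where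
  base: "yao_yao 0 (\<lambda>_. UNIV) {\<phi>. fst (\<phi> []) = 0}"
| step: "yao_yao (Suc m)
      (\<lambda>s. C (tl s) \<inter> {x. if hd s then aff (g (tl s)) x < b m \<bullet> x else b m \<bullet> x < aff (g (tl s)) x})
      {\<phi>. \<exists>\<psi>\<in>L. \<exists>\<kappa>. \<forall>s i. length i = m \<longrightarrow> \<phi> (s # i) = \<psi> i + \<kappa> i *\<^sub>R ((b m, 0) - g i)}"
  if "yao_yao m C L" "g \<in> L"

lemma yao_yao_in_initial_affine:
  assumes "yao_yao m C L" "\<phi> \<in> L" "length i = m" "m \<le> DIM('a)"
  shows "\<phi> i \<in> initial_affine m"
  using assms
proof (induction arbitrary: \<phi> i rule: yao_yao.induct)
  case base
  then show ?case by (auto simp: initial_affine_def)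
next
  case (step m C L g)
  obtain s j where i: "i = s # j" "length j = m" using step.prems by (auto simp: length_Suc_conv)
  obtain \<psi> \<kappa> where \<psi>: "\<psi> \<in> L" "\<phi> (s # j) = \<psi> j + \<kappa> j *\<^sub>R ((b m, 0) - g j)"
    using step.prems i by blast
  have "\<psi> j \<in> initial_affine (Suc m)" "g j \<in> initial_affine (Suc m)"
    using step.IH[of \<psi> j] step.IH[of g j] step.hyps \<psi> i step.prems initial_affine_mono[of m "Suc m"] by auto
  moreover have "(b m, 0) \<in> initial_affine (Suc m)"
    using step.prems by (auto simp: initial_affine_def inner_frame)
  ultimately show ?case
    unfolding i \<psi>(2) by (intro subspace_add subspace_scale subspace_diff subspace_initial_affine)
qed

text \<open>Slopes combine linearly cell by cell, so \<open>L\<close> is a linear space. Hence two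
  of its elements can be compared through their difference.\<close>

lemma yao_yao_add_scale:
  assumes "yao_yao m C L" "\<phi> \<in> L" "\<psi> \<in> L"
  shows "(\<lambda>i. \<phi> i + r *\<^sub>R \<psi> i) \<in> L"
  using assms
proof (induction arbitrary: \<phi> \<psi> rule: yao_yao.induct)
  case base
  then show ?case by auto
next
  case (step m C L g)
  define e where "e i = (b m, 0) - g i" for i
  obtain \<phi>' \<kappa> where 1: "\<phi>' \<in> L" "\<forall>s i. length i = m \<longrightarrow> \<phi> (s # i) = \<phi>' i + \<kappa> i *\<^sub>R e i"
    using step.prems unfolding e_def by blast
  obtain \<psi>' \<kappa>' where 2: "\<psi>' \<in> L" "\<forall>s i. length i = m \<longrightarrow> \<psi> (s # i) = \<psi>' i + \<kappa>' i *\<^sub>R e i"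
    using step.prems unfolding e_def by blast
  have "\<forall>s i. length i = m \<longrightarrow> \<phi> (s # i) + r *\<^sub>R \<psi> (s # i) =
      (\<phi>' i + r *\<^sub>R \<psi>' i) + (\<kappa> i + r * \<kappa>' i) *\<^sub>R e i"
    using 1 2 by (simp add: algebra_simps)
  then show ?case
    using step.IH[OF 1(1) 2(1)] unfolding e_def mem_Collect_eq
    by (intro bexI[of _ "\<lambda>i. \<phi>' i + r *\<^sub>R \<psi>' i"] exI[of _ "\<lambda>i. \<kappa> i + r * \<kappa>' i"])
qed

lemma yao_yao_diff:
  assumes "yao_yao m C L" "\<phi> \<in> L" "\<psi> \<in> L"
  shows "(\<lambda>i. \<phi> i - \<psi> i) \<in> L"
  using yao_yao_add_scale[OF assms, of "-1"] by simp

text \<open>This is how hyperplanes enter: their defining functions become elements of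
  \<open>L\<close> given by the same pair on every cell.\<close>

lemma yao_yao_affine:
  assumes "yao_yao m C L" "m \<le> DIM('a)" "p \<in> initial_affine m"
  shows "(\<lambda>_. p) \<in> L"
  using assms
proof (induction arbitrary: p rule: yao_yao.induct)
  case base
  have "fst p \<bullet> u = 0" if "u \<in> Basis" for u
  proof -
    obtain k where "k < DIM('a)" "u = b k"
      using bij_betw_imp_surj_on[OF bij] \<open>u \<in> Basis\<close> by (metis imageE lessThan_iff)
    then show ?thesis using base.prems by (simp add: initial_affine_def)
  qed
  then have "fst p = 0" using euclidean_all_zero_iff by blast
  then show ?case by simp
next
  case (step m C L g)
  define r where "r = fst p \<bullet> b m"
  have "p - r *\<^sub>R (b m, 0) \<in> initial_affine m"
    unfolding initial_affine_def mem_Collect_eq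
  proof (intro allI impI)
    fix k assume "m \<le> k" "k < DIM('a)"
    then show "fst (p - r *\<^sub>R (b m, 0)) \<bullet> b k = 0"
      using step.prems by (cases "k = m") (auto simp: initial_affine_def r_def inner_diff_left inner_frame)
  qed
  then have "(\<lambda>_. p - r *\<^sub>R (b m, 0)) \<in> L" using step.IH step.prems by simp
  \<comment> \<open>The term \<open>r y\<close> in the new coordinate \<open>y\<close> is split as
    \<open>r g + r (y - g)\<close>: the first summand belongs to \<open>L\<close>, the second has
    slope \<open>r\<close> on all cells.\<close>
  then have "(\<lambda>i. (p - r *\<^sub>R (b m, 0)) + r *\<^sub>R g i) \<in> L"
    using yao_yao_add_scale[OF step.hyps(1) _ step.hyps(2)] by blast
  moreover have "p = (p - r *\<^sub>R (b m, 0)) + r *\<^sub>R g i + r *\<^sub>R ((b m, 0) - g i)" for i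
    by (simp only: scaleR_diff_right) simp
  ultimately show ?case
    unfolding mem_Collect_eq
    by (intro bexI[of _ "\<lambda>i. (p - r *\<^sub>R (b m, 0)) + r *\<^sub>R g i"] exI[of _ "\<lambda>_. r"] allI impI)
qed

text \<open>Cells are finite intersections of open half-spaces whose boundaries do not involve later
  coordinates, hence the invariance under shifts in those directions.\<close>

lemma yao_yao_cells:
  assumes "yao_yao m C L" "length i = m" "m \<le> DIM('a)"
  shows "open (C i)" "convex (C i)"
    and "\<And>k x r. m \<le> k \<Longrightarrow> k < DIM('a) \<Longrightarrow> x \<in> C i \<Longrightarrow> x + r *\<^sub>R b k \<in> C i"
proof -
  have "open (C i) \<and> convex (C i) \<and>
    (\<forall>k x r. m \<le> k \<longrightarrow> k < DIM('a) \<longrightarrow> x \<in> C i \<longrightarrow> x + r *\<^sub>R b k \<in> C i)"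
    using assms
  proof (induction arbitrary: i rule: yao_yao.induct)
    case base
    then show ?case by simp
  next
    case (step m C L g)
    obtain s j where i: "i = s # j" "length j = m" using step.prems by (auto simp: length_Suc_conv)
    have gS: "g j \<in> initial_affine m" using yao_yao_in_initial_affine step.hyps step.prems i by simp
    define H where "H = {x. if s then aff (g j) x < b m \<bullet> x else b m \<bullet> x < aff (g j) x}"
    have eq: "H = (if s then {x. (b m - fst (g j)) \<bullet> x > snd (g j)} else {x. (b m - fst (g j)) \<bullet> x < snd (g j)})"
      by (auto simp: H_def aff_def inner_diff_left)
    have H: "open H" "convex H"
      unfolding eq by (auto simp: open_halfspace_gt open_halfspace_lt convex_halfspace_gt convex_halfspace_lt)
    have shift: "x + r *\<^sub>R b k \<in> H" if "x \<in> H" "Suc m \<le> k" "k < DIM('a)" for k x r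
      using that aff_shift[OF gS, of k x r] by (auto simp: H_def inner_add_right inner_frame)
    have IH: "open (C j)" "convex (C j)"
      "\<And>k x r. m \<le> k \<Longrightarrow> k < DIM('a) \<Longrightarrow> x \<in> C j \<Longrightarrow> x + r *\<^sub>R b k \<in> C j"
      using step.IH[of j] i step.prems by auto
    show ?case
      unfolding i list.sel H_def[symmetric]
      using H IH(1,2) by (auto intro!: IH(3) shift convex_Int open_Int)
  qed
  then show "open (C i)" "convex (C i)"
    and "\<And>k x r. m \<le> k \<Longrightarrow> k < DIM('a) \<Longrightarrow> x \<in> C i \<Longrightarrow> x + r *\<^sub>R b k \<in> C i" by blast+
qed

lemma yao_yao_disjoint:
  assumes "yao_yao m C L" "length i = m" "length j = m" "i \<noteq> j"
  shows "C i \<inter> C j = {}"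
  using assms
proof (induction arbitrary: i j rule: yao_yao.induct)
  case base
  then show ?case by simp
next
  case (step m C L g)
  then obtain s i' s' j' where "i = s # i'" "length i' = m" "j = s' # j'" "length j' = m"
    by (auto simp: length_Suc_conv)
  then show ?case using step.IH[of i' j'] step.prems by (cases "i' = j'") (auto split: if_splits)
qed

text \<open>Following the sign of \<open>\<kappa>\<close> at each level leads from the centre \<open>z\<close> into a cell on which
  \<open>\<phi>\<close> keeps its sign.\<close>

lemma yao_yao_center:
  assumes "yao_yao m C L" "m \<le> DIM('a)"
  shows "\<exists>z. \<forall>\<phi>\<in>L. \<exists>c. (\<forall>i. length i = m \<longrightarrow> aff (\<phi> i) z = c) \<and>
    (0 \<le> c \<longrightarrow> (\<exists>i. length i = m \<and> (\<forall>x\<in>C i. 0 \<le> aff (\<phi> i) x)))"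
  using assms
proof (induction rule: yao_yao.induct)
  case base
  then show ?case by (auto simp: aff_def)
next
  case (step m C L g)
  then obtain z where z: "\<And>\<phi>. \<phi> \<in> L \<Longrightarrow> \<exists>c. (\<forall>i. length i = m \<longrightarrow> aff (\<phi> i) z = c) \<and>
    (0 \<le> c \<longrightarrow> (\<exists>i. length i = m \<and> (\<forall>x\<in>C i. 0 \<le> aff (\<phi> i) x)))" by auto
  obtain c where c: "\<And>i. length i = m \<Longrightarrow> aff (g i) z = c" using z step.hyps by blast
  \<comment> \<open>Moving along \<open>b m\<close> leaves all old functions unchanged. As
    \<open>g\<close> has the common value \<open>c\<close> at \<open>z\<close>, one shift makes
    \<open>y - g\<close> vanish at \<open>z'\<close> for all cells at once.\<close>
  define z' where "z' = z + (c - b m \<bullet> z) *\<^sub>R b m"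
  have z': "aff (\<psi> i) z' = aff (\<psi> i) z" if "\<psi> \<in> L" "length i = m" for \<psi> i
    unfolding z'_def using yao_yao_in_initial_affine step that aff_shift[of "\<psi> i" m m] by auto
  have bz': "aff (b m, 0) z' = c"
    using step.prems by (simp add: aff_def z'_def inner_add_right inner_frame)
  show ?case
  proof (intro exI[of _ z'] ballI)
    fix \<phi> assume "\<phi> \<in> {\<phi>. \<exists>\<psi>\<in>L. \<exists>\<kappa>. \<forall>s i. length i = m \<longrightarrow> \<phi> (s # i) = \<psi> i + \<kappa> i *\<^sub>R ((b m, 0) - g i)}"
    then obtain \<psi> \<kappa> where \<psi>: "\<psi> \<in> L"
      and \<phi>: "\<And>s i. length i = m \<Longrightarrow> \<phi> (s # i) = \<psi> i + \<kappa> i *\<^sub>R ((b m, 0) - g i)" by blast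
    obtain c' where c': "\<And>i. length i = m \<Longrightarrow> aff (\<psi> i) z = c'"
      and ex: "0 \<le> c' \<Longrightarrow> \<exists>i. length i = m \<and> (\<forall>x\<in>C i. 0 \<le> aff (\<psi> i) x)" using z[OF \<psi>] by blast
    have "aff (\<phi> i) z' = c'" if i: "length i = Suc m" for i
    proof -
      obtain s j where "i = s # j" "length j = m" using i by (auto simp: length_Suc_conv)
      then show ?thesis by (simp add: \<phi> aff_add aff_diff aff_scaleR bz' z' \<psi> step.hyps c c')
    qed
    moreover have "\<exists>i. length i = Suc m \<and> (\<forall>x\<in>C (tl i) \<inter> {x. if hd i then aff (g (tl i)) x < b m \<bullet> x
          else b m \<bullet> x < aff (g (tl i)) x}. 0 \<le> aff (\<phi> i) x)" if nonneg: "0 \<le> c'"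
    proof -
      obtain i where i: "length i = m" "\<forall>x\<in>C i. 0 \<le> aff (\<psi> i) x" using ex[OF nonneg] by blast
      show ?thesis
        \<comment> \<open>The sign of \<open>\<kappa> i\<close> selects the half of the cell on
          which \<open>\<kappa> i (y - g i)\<close> is nonnegative.\<close>
        using i by (intro exI[of _ "(0 \<le> \<kappa> i) # i"])
          (auto simp: \<phi> aff_simps aff_def[of "(b m, 0)"] zero_le_mult_iff intro!: add_nonneg_nonneg)
    qed
    ultimately show "\<exists>c. (\<forall>i. length i = Suc m \<longrightarrow> aff (\<phi> i) z' = c) \<and>
      (0 \<le> c \<longrightarrow> (\<exists>i. length i = Suc m \<and> (\<forall>x\<in>C (tl i) \<inter> {x. if hd i then aff (g (tl i)) x < b m \<bullet> x
          else b m \<bullet> x < aff (g (tl i)) x}. 0 \<le> aff (\<phi> i) x)))" by blast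
  qed
qed

text \<open>The two conditions on the halves of an old cell share the unknown slope there.
  Eliminating it leaves one threshold condition per old cell, to which induction applies; at level 0
  a single constant remains to be found.\<close>

lemma yao_yao_solve:
  assumes "yao_yao m C L" "m \<le> DIM('a)" "\<And>i. length i = m \<Longrightarrow> threshold (initial_affine m) (C i) (T i)"
  shows "\<exists>\<phi>\<in>L. \<forall>i. length i = m \<longrightarrow> T i (\<phi> i) = 0"
  using assms
proof (induction arbitrary: T rule: yao_yao.induct)
  case base
  have "(0, 1) \<in> initial_affine 0" "0 \<in> initial_affine 0" by (auto simp: initial_affine_def)
  then obtain r where "T [] (0 + r *\<^sub>R (0, 1)) = 0"
    using threshold_root[OF subspace_initial_affine base.prems(2)[of "[]"], of 0 "(0, 1)"] by (auto simp: aff_def)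
  then show ?case by (intro bexI[of _ "\<lambda>_. (0, r)"]) auto
next
  case (step m C L g)
  define e where "e i = (b m, 0) - g i" for i
  have aff_e: "aff (e i) x = b m \<bullet> x - aff (g i) x" for i x
    by (simp add: e_def aff_simps aff_def[of "(b m, 0)"])
  have ex: "\<exists>\<kappa>. (\<forall>p\<in>initial_affine m. T (True # i) (p + \<kappa> p *\<^sub>R e i) = 0) \<and>
      threshold (initial_affine m) (C i) (\<lambda>p. T (False # i) (p + \<kappa> p *\<^sub>R e i))" if i: "length i = m" for i
  proof -
    have sub: "initial_affine m \<subseteq> initial_affine (Suc m)" by (simp add: initial_affine_mono)
    have "g i \<in> initial_affine (Suc m)" using yao_yao_in_initial_affine[OF step.hyps i] step.prems sub by auto
    moreover have "(b m, 0) \<in> initial_affine (Suc m)" using step.prems by (auto simp: initial_affine_def inner_frame)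
    ultimately have "e i \<in> initial_affine (Suc m)" unfolding e_def by (intro subspace_diff subspace_initial_affine)
    moreover have "threshold (initial_affine (Suc m)) (C i \<inter> {x. aff (g i) x < b m \<bullet> x}) (T (True # i))"
      "threshold (initial_affine (Suc m)) (C i \<inter> {x. b m \<bullet> x < aff (g i) x}) (T (False # i))"
      using step.prems(2)[of "True # i"] step.prems(2)[of "False # i"] i by simp_all
    ultimately obtain \<kappa> where root: "\<And>p. p \<in> initial_affine (Suc m) \<Longrightarrow> T (True # i) (p + \<kappa> p *\<^sub>R e i) = 0"
      and thr: "threshold (initial_affine (Suc m)) (C i) (\<lambda>p. T (False # i) (p + \<kappa> p *\<^sub>R e i))"
      using threshold_eliminate[OF subspace_initial_affine, of "e i" "Suc m" "C i \<inter> {x. aff (g i) x < b m \<bullet> x}" "T (True # i)"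
        "C i \<inter> {x. b m \<bullet> x < aff (g i) x}" "T (False # i)" "C i"]
      by (auto simp: aff_e)
    \<comment> \<open>The elimination needs functions involving \<open>b m\<close>; the induction
      hypothesis is about functions of the first \<open>m\<close> coordinates, hence the
      restriction.\<close>
    show ?thesis
      using threshold_subset[OF thr sub] root subsetD[OF sub] by (intro exI[of _ \<kappa>]) simp
  qed
  obtain \<kappa> where "\<forall>i. length i = m \<longrightarrow> (\<forall>p\<in>initial_affine m. T (True # i) (p + \<kappa> i p *\<^sub>R e i) = 0) \<and>
      threshold (initial_affine m) (C i) (\<lambda>p. T (False # i) (p + \<kappa> i p *\<^sub>R e i))"
    using choice[of "\<lambda>i \<kappa>. length i = m \<longrightarrow> (\<forall>p\<in>initial_affine m. T (True # i) (p + \<kappa> p *\<^sub>R e i) = 0) \<and>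
      threshold (initial_affine m) (C i) (\<lambda>p. T (False # i) (p + \<kappa> p *\<^sub>R e i))"] ex by blast
  then have \<kappa>: "\<And>i p. length i = m \<Longrightarrow> p \<in> initial_affine m \<Longrightarrow> T (True # i) (p + \<kappa> i p *\<^sub>R e i) = 0"
    and th: "\<And>i. length i = m \<Longrightarrow> threshold (initial_affine m) (C i) (\<lambda>p. T (False # i) (p + \<kappa> i p *\<^sub>R e i))"
    by auto
  obtain \<psi> where \<psi>: "\<psi> \<in> L" "\<And>i. length i = m \<Longrightarrow> T (False # i) (\<psi> i + \<kappa> i (\<psi> i) *\<^sub>R e i) = 0"
    using step.IH[OF _ th] step.prems by auto
  have \<psi>initial_affine: "\<psi> i \<in> initial_affine m" if "length i = m" for i
    using yao_yao_in_initial_affine[OF step.hyps(1) \<psi>(1) that] step.prems by simp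
  \<comment> \<open>Both halves of a cell receive the same slope, as membership in the new space
    demands, so only the tail of the index matters.\<close>
  define \<phi> where "\<phi> s = \<psi> (tl s) + \<kappa> (tl s) (\<psi> (tl s)) *\<^sub>R e (tl s)" for s
  have "T s (\<phi> s) = 0" if s: "length s = Suc m" for s
  proof -
    obtain h j where "s = h # j" "length j = m" using s by (auto simp: length_Suc_conv)
    then show ?thesis using \<psi> \<kappa> \<psi>initial_affine by (cases h) (auto simp: \<phi>_def)
  qed
  moreover have "\<exists>\<psi>\<in>L. \<exists>\<kappa>. \<forall>s i. length i = m \<longrightarrow> \<phi> (s # i) = \<psi> i + \<kappa> i *\<^sub>R ((b m, 0) - g i)"
    using \<psi>(1) by (auto simp: \<phi>_def e_def)
  ultimately show ?case by blast
qed

end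

section \<open>Cutting a measure\<close>

text \<open>Dominated convergence for indicators, with the constant 1 as bound. It serves both for
  the continuity of cut-off masses and for the final limit.\<close>

lemma (in finite_measure) measure_tendsto_of_AE:
  assumes [measurable]: "\<And>n. A n \<in> sets M" "B \<in> sets M"
    and ae: "AE x in M. \<forall>\<^sub>F n in sequentially. x \<in> A n \<longleftrightarrow> x \<in> B"
  shows "(\<lambda>n. measure M (A n)) \<longlonglongrightarrow> measure M B"
proof -
  have "(\<lambda>n. integral\<^sup>L M (indicat_real (A n))) \<longlonglongrightarrow> integral\<^sup>L M (indicat_real B)"
  proof (rule integral_dominated_convergence[where w = "\<lambda>_. 1"])
    show "AE x in M. (\<lambda>n. indicat_real (A n) x) \<longlonglongrightarrow> indicat_real B x"
      using ae
    proof eventually_elim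
      case (elim x)
      then have "\<forall>\<^sub>F n in sequentially. indicat_real (A n) x = indicat_real B x"
        by eventually_elim (auto simp: indicator_def)
      then show ?case by (rule tendsto_eventually)
    qed
  qed (auto simp: indicator_def)
  then show ?thesis by simp
qed

lemma null_sets_of_negligible:
  assumes "absolutely_continuous lborel M" "negligible A" "A \<in> sets borel"
  shows "A \<in> null_sets M"
proof -
  have "A \<in> null_sets lborel"
    using assms null_sets_completion_iff[of A lborel] by (simp add: negligible_iff_null_sets)
  then show ?thesis using assms(1) by (auto simp: absolutely_continuous_def)
qed

locale yao_yao_measure = coordinate_frame b + finite_measure M
  for b :: "nat \<Rightarrow> 'a::euclidean_space" and M :: "'a measure" +
  assumes sets_M: "sets M = sets borel"
    and ac: "absolutely_continuous lborel M"
    and open_pos: "\<And>U. open U \<Longrightarrow> U \<noteq> {} \<Longrightarrow> 0 < measure M U"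
begin

lemma open_in_sets [measurable]: "open U \<Longrightarrow> U \<in> sets M"
  by (simp add: sets_M)

lemma open_cut:
  assumes "open U"
  shows "open (U \<inter> {x. u \<bullet> x < aff p x})" "open (U \<inter> {x. aff p x < u \<bullet> x})"
  using assms by (auto intro!: open_Int open_Collect_less continuous_intros)

lemma null_graph:
  assumes "m < DIM('a)" "p \<in> initial_affine m"
  shows "{x. b m \<bullet> x = aff p x} \<in> null_sets M"
proof (rule null_sets_of_negligible[OF ac])
  have "(b m - fst p) \<bullet> b m = 1"
    using assms by (simp add: initial_affine_def inner_diff_left inner_frame)
  then have "b m - fst p \<noteq> 0" by auto
  moreover have "{x. b m \<bullet> x = aff p x} = {x. (b m - fst p) \<bullet> x = snd p}"
    by (auto simp: aff_def inner_diff_left)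
  ultimately show "negligible {x. b m \<bullet> x = aff p x}" by (simp add: negligible_hyperplane)
  show "{x. b m \<bullet> x = aff p x} \<in> sets borel"
    by (intro borel_closed closed_Collect_eq continuous_intros)
qed

text \<open>Here \<open>U\<close> is the part of the cell \<open>V\<close> left above earlier cuts.
  Null graphs give continuity, positive mass of open sets gives strictness, and the bounds on
  \<beta> give both signs.\<close>

lemma threshold_measure:
  assumes m: "m < DIM('a)" and U: "open U" "U \<subseteq> V"
    and up: "\<And>x r. x \<in> U \<Longrightarrow> 0 \<le> r \<Longrightarrow> x + r *\<^sub>R b m \<in> U"
    and \<beta>: "0 < \<beta>" "\<beta> < measure M U"
  shows "threshold (initial_affine m) V (\<lambda>p. measure M (U \<inter> {x. b m \<bullet> x < aff p x}) - \<beta>)"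
proof -
  define G where "G p = U \<inter> {x. b m \<bullet> x < aff p x}" for p
  have Gs [measurable]: "G p \<in> sets M" for p
    unfolding G_def by (intro open_in_sets open_cut U)
  have Us [measurable]: "U \<in> sets M" by (intro open_in_sets U)
  have mono: "measure M (G p) \<le> measure M (G q)" if "\<forall>x\<in>V. aff p x \<le> aff q x" for p q
    using that U by (intro finite_measure_mono Gs) (force simp: G_def)
  have "continuous_on (initial_affine m) (\<lambda>p. measure M (G p))"
    unfolding continuous_on_sequentially
  proof (intro allI ballI impI, elim conjE)
    fix P and p assume p: "p \<in> initial_affine m" "\<forall>n. P n \<in> initial_affine m" "P \<longlonglongrightarrow> p"
    have "AE x in M. b m \<bullet> x \<noteq> aff p x"
      using AE_not_in[OF null_graph[OF m p(1)]] by simp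
    then have "AE x in M. \<forall>\<^sub>F n in sequentially. x \<in> G (P n) \<longleftrightarrow> x \<in> G p"
    proof eventually_elim
      case (elim x)
      have lim: "(\<lambda>n. aff (P n) x) \<longlonglongrightarrow> aff p x"
        unfolding aff_def by (intro tendsto_intros p)
      consider "b m \<bullet> x < aff p x" | "aff p x < b m \<bullet> x" using elim by linarith
      then show ?case
      proof cases
        case 1
        then show ?thesis using order_tendstoD(1)[OF lim 1] by (auto simp: G_def elim!: eventually_mono)
      next
        case 2
        then show ?thesis using order_tendstoD(2)[OF lim 2] by (auto simp: G_def elim!: eventually_mono)
      qed
    qed
    then show "((\<lambda>p. measure M (G p)) \<circ> P) \<longlonglongrightarrow> measure M (G p)"
      unfolding o_def by (intro measure_tendsto_of_AE Gs)
  qed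
  moreover have "measure M (G p) < measure M (G q)"
    if pq: "p \<in> initial_affine m" "q \<in> initial_affine m" and less: "\<forall>x\<in>V. aff p x < aff q x" and q: "0 \<le> measure M (G q) - \<beta>" for p q
  proof -
    \<comment> \<open>Positivity of \<beta> enters here: it forces a point of \<open>U\<close> below
      the graph of \<open>q\<close>.\<close>
    have "measure M (G q) > 0" using q \<beta> by simp
    then have "G q \<noteq> {}" by auto
    then obtain x where x: "x \<in> U" "b m \<bullet> x < aff q x" by (auto simp: G_def)
    \<comment> \<open>A height between the two graphs and above the height of \<open>x\<close>:
      raising \<open>x\<close> to it stays inside \<open>U\<close> and reaches an open set lying in
      the part for \<open>q\<close> but not in the part for \<open>p\<close>.\<close>
    define s where "s = (max (b m \<bullet> x) (aff p x) + aff q x) / 2"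
    have s: "b m \<bullet> x < s" "aff p x < s" "s < aff q x"
      using x less U by (auto simp: s_def max_def field_simps)
    define y where "y = x + (s - b m \<bullet> x) *\<^sub>R b m"
    have "aff p y = aff p x" "aff q y = aff q x"
      unfolding y_def using aff_shift pq m by auto
    moreover have "b m \<bullet> y = s" using m by (simp add: y_def inner_add_right inner_frame)
    moreover have "y \<in> U" unfolding y_def using s by (intro up x) auto
    ultimately have "y \<in> G q \<inter> {x. aff p x < b m \<bullet> x}" using s by (simp add: G_def)
    moreover have op: "open (G q \<inter> {x. aff p x < b m \<bullet> x})"
      unfolding G_def by (intro open_cut U)
    ultimately have "0 < measure M (G q \<inter> {x. aff p x < b m \<bullet> x})" by (intro open_pos) auto
    moreover have "measure M (G p) + measure M (G q \<inter> {x. aff p x < b m \<bullet> x})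
        = measure M (G p \<union> (G q \<inter> {x. aff p x < b m \<bullet> x}))"
      by (intro finite_measure_Union[symmetric] Gs open_in_sets op) (auto simp: G_def)
    moreover have "\<dots> \<le> measure M (G q)"
      using less U by (intro finite_measure_mono Gs) (force simp: G_def)
    ultimately show ?thesis by simp
  qed
  moreover have "(\<exists>r. 0 < measure M (G (p + r *\<^sub>R e)) - \<beta>) \<and> (\<exists>r. measure M (G (p + r *\<^sub>R e)) - \<beta> < 0)"
    if pos: "\<forall>x\<in>V. 0 < aff e x" for p e
  proof
    have ev: "\<forall>\<^sub>F n in sequentially. b m \<bullet> x - aff p x < real n * aff e x"
      "\<forall>\<^sub>F n in sequentially. aff p x - b m \<bullet> x < real n * aff e x" if "x \<in> U" for x
    proof -
      have "filterlim (\<lambda>n. real n * aff e x) at_top sequentially"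
        using that pos U by (intro filterlim_at_top_mult_tendsto_pos[OF tendsto_const _ filterlim_real_sequentially]) auto
      then show "\<forall>\<^sub>F n in sequentially. b m \<bullet> x - aff p x < real n * aff e x"
        "\<forall>\<^sub>F n in sequentially. aff p x - b m \<bullet> x < real n * aff e x"
        by (auto simp: filterlim_at_top_dense)
    qed
    \<comment> \<open>Adding large multiples of \<open>e\<close> lifts the graph above each point of
      \<open>U\<close>; subtracting them, further below, sinks it beneath each point.\<close>
    have "(\<lambda>n. measure M (G (p + real n *\<^sub>R e))) \<longlonglongrightarrow> measure M U"
    proof (intro measure_tendsto_of_AE Gs Us AE_I2)
      fix x show "\<forall>\<^sub>F n in sequentially. x \<in> G (p + real n *\<^sub>R e) \<longleftrightarrow> x \<in> U"
      proof (cases "x \<in> U")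
        case True
        show ?thesis using ev(1)[OF True] by eventually_elim (auto simp: G_def aff_simps True)
      qed (simp add: G_def)
    qed
    then have "\<forall>\<^sub>F n in sequentially. \<beta> < measure M (G (p + real n *\<^sub>R e))"
      using \<beta> order_tendstoD(1) by blast
    then show "\<exists>r. 0 < measure M (G (p + r *\<^sub>R e)) - \<beta>"
      by (auto dest!: eventually_happens)
    have "(\<lambda>n. measure M (G (p + (- real n) *\<^sub>R e))) \<longlonglongrightarrow> measure M {}"
    proof (intro measure_tendsto_of_AE Gs sets.empty_sets AE_I2)
      fix x show "\<forall>\<^sub>F n in sequentially. x \<in> G (p + (- real n) *\<^sub>R e) \<longleftrightarrow> x \<in> {}"
      proof (cases "x \<in> U")
        case True
        show ?thesis using ev(2)[OF True] by eventually_elim (auto simp: G_def aff_simps)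
      qed (simp add: G_def)
    qed
    then have "\<forall>\<^sub>F n in sequentially. measure M (G (p + (- real n) *\<^sub>R e)) < \<beta>"
      using \<beta> order_tendstoD(2) by fastforce
    then obtain n where "measure M (G (p + (- real n) *\<^sub>R e)) < \<beta>"
      by (auto dest!: eventually_happens)
    then show "\<exists>r. measure M (G (p + r *\<^sub>R e)) - \<beta> < 0"
      by (intro exI[of _ "- real n"]) simp
  qed
  ultimately show ?thesis
    unfolding threshold_def G_def[symmetric] using mono by (auto intro!: continuous_intros)
qed

text \<open>One element of \<open>L\<close> cuts all the sets \<open>U i\<close> simultaneously. The
  mass above the cut is the complementary one because the graph is a null set.\<close>

lemma yao_yao_cut:
  assumes Y: "yao_yao m C L" and m: "m < DIM('a)"
    and U: "\<And>i. length i = m \<Longrightarrow> open (U i)" "\<And>i. length i = m \<Longrightarrow> U i \<subseteq> C i"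
    and up: "\<And>i x r. length i = m \<Longrightarrow> x \<in> U i \<Longrightarrow> 0 \<le> r \<Longrightarrow> x + r *\<^sub>R b m \<in> U i"
    and \<beta>: "\<And>i. length i = m \<Longrightarrow> 0 < \<beta> i" "\<And>i. length i = m \<Longrightarrow> \<beta> i < measure M (U i)"
  obtains g where "g \<in> L"
    and "\<And>i. length i = m \<Longrightarrow> measure M (U i \<inter> {x. b m \<bullet> x < aff (g i) x}) = \<beta> i"
    and "\<And>i. length i = m \<Longrightarrow> measure M (U i \<inter> {x. aff (g i) x < b m \<bullet> x}) = measure M (U i) - \<beta> i"
proof -
  obtain g where g: "g \<in> L"
    "\<And>i. length i = m \<Longrightarrow> measure M (U i \<inter> {x. b m \<bullet> x < aff (g i) x}) = \<beta> i"
    using yao_yao_solve[OF Y, where T = "\<lambda>i p. measure M (U i \<inter> {x. b m \<bullet> x < aff p x}) - \<beta> i"]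
      threshold_measure[OF m U up \<beta>] m by fastforce
  have "measure M (U i \<inter> {x. aff (g i) x < b m \<bullet> x}) = measure M (U i) - \<beta> i" if i: "length i = m" for i
  proof -
    let ?L = "U i \<inter> {x. b m \<bullet> x < aff (g i) x}" and ?R = "U i \<inter> {x. aff (g i) x < b m \<bullet> x}"
    have sets: "?L \<in> sets M" "?R \<in> sets M" "U i \<in> sets M"
      by (intro open_in_sets open_cut U i)+
    have gi: "g i \<in> initial_affine m" using yao_yao_in_initial_affine[OF Y g(1) i] m by simp
    have "AE x in M. x \<in> U i \<longleftrightarrow> x \<in> ?L \<union> ?R"
      using AE_not_in[OF null_graph[OF m gi]] by eventually_elim auto
    then have "measure M (U i) = measure M (?L \<union> ?R)"
      using sets by (intro finite_measure_eq_AE) auto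
    also have "\<dots> = measure M ?L + measure M ?R"
      using sets by (intro finite_measure_Union) auto
    finally show ?thesis using g(2)[OF i] by simp
  qed
  with g show thesis using that by blast
qed

lemma measure_UNIV_pos: "0 < measure M UNIV"
  by (rule open_pos) auto

lemma yao_yao_exists:
  assumes "m < DIM('a)"
  shows "\<exists>C L. yao_yao m C L \<and> (\<forall>i. length i = m \<longrightarrow> measure M (C i) = measure M UNIV / 2 ^ m)"
  using assms
proof (induction m)
  case 0
  then show ?case using yao_yao.base by force
next
  case (Suc m)
  then obtain C L where Y: "yao_yao m C L"
    and C: "\<And>i. length i = m \<Longrightarrow> measure M (C i) = measure M UNIV / 2 ^ m" by auto
  have m: "m < DIM('a)" using Suc.prems by simp
  note cells = yao_yao_cells[OF Y _ less_imp_le[OF m]]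
  obtain g where g: "g \<in> L"
    "\<And>i. length i = m \<Longrightarrow> measure M (C i \<inter> {x. b m \<bullet> x < aff (g i) x}) = measure M UNIV / 2 ^ Suc m"
    "\<And>i. length i = m \<Longrightarrow> measure M (C i \<inter> {x. aff (g i) x < b m \<bullet> x}) = measure M (C i) - measure M UNIV / 2 ^ Suc m"
    by (rule yao_yao_cut[OF Y m, where U = C and \<beta> = "\<lambda>_. measure M UNIV / 2 ^ Suc m"])
      (use cells m measure_UNIV_pos in \<open>auto simp: C field_simps\<close>)
  show ?case
  proof (intro exI conjI allI impI)
    show "yao_yao (Suc m)
      (\<lambda>s. C (tl s) \<inter> {x. if hd s then aff (g (tl s)) x < b m \<bullet> x else b m \<bullet> x < aff (g (tl s)) x})
      {\<phi>. \<exists>\<psi>\<in>L. \<exists>\<kappa>. \<forall>s i. length i = m \<longrightarrow> \<phi> (s # i) = \<psi> i + \<kappa> i *\<^sub>R ((b m, 0) - g i)}"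
      by (rule yao_yao.step[OF Y g(1)])
    fix i :: "bool list" assume i: "length i = Suc m"
    then show "measure M (C (tl i) \<inter> {x. if hd i then aff (g (tl i)) x < b m \<bullet> x else b m \<bullet> x < aff (g (tl i)) x}) =
      measure M UNIV / 2 ^ Suc m"
      using g(2)[of "tl i"] g(3)[of "tl i"] C[of "tl i"] by (cases "hd i") (auto simp: field_simps)
  qed
qed

text \<open>Each cut removes one share from the bottom of what the earlier cuts left. All cuts
  belong to the same \<open>L\<close>, so they remain comparable with one another and with
  hyperplanes.\<close>

lemma yao_yao_cuts:
  assumes Y: "yao_yao m C L" and m: "m < DIM('a)"
    and pos: "\<And>i. length i = m \<Longrightarrow> 0 < measure M (C i)"
    and "k \<le> t"
  shows "\<exists>g. (\<forall>l<k. g l \<in> L) \<and> (\<forall>i. length i = m \<longrightarrow>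
      (\<forall>l<k. measure M (C i \<inter> {x. \<forall>j<l. aff (g j i) x < b m \<bullet> x} \<inter> {x. b m \<bullet> x < aff (g l i) x})
           = measure M (C i) / real (t + 1)) \<and>
      measure M (C i \<inter> {x. \<forall>j<k. aff (g j i) x < b m \<bullet> x}) = real (t + 1 - k) * (measure M (C i) / real (t + 1)))"
  using \<open>k \<le> t\<close>
proof (induction k)
  case 0
  then show ?case by simp
next
  case (Suc k)
  define \<beta> where "\<beta> i = measure M (C i) / real (t + 1)" for i
  have \<beta>: "0 < \<beta> i" if "length i = m" for i using pos[OF that] by (simp add: \<beta>_def)
  note cells = yao_yao_cells[OF Y _ less_imp_le[OF m]]
  obtain g where g: "\<And>l. l < k \<Longrightarrow> g l \<in> L"
    "\<And>i l. length i = m \<Longrightarrow> l < k \<Longrightarrow>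
       measure M (C i \<inter> {x. \<forall>j<l. aff (g j i) x < b m \<bullet> x} \<inter> {x. b m \<bullet> x < aff (g l i) x}) = \<beta> i"
    "\<And>i. length i = m \<Longrightarrow> measure M (C i \<inter> {x. \<forall>j<k. aff (g j i) x < b m \<bullet> x}) = real (t + 1 - k) * \<beta> i"
    using Suc unfolding \<beta>_def by auto
  have open_U: "open (C i \<inter> {x. \<forall>j<k. aff (g j i) x < b m \<bullet> x})" if "length i = m" for i
  proof -
    have "{x. \<forall>j<k. aff (g j i) x < b m \<bullet> x} = (\<Inter>j<k. {x. aff (g j i) x < b m \<bullet> x})" by auto
    moreover have "open \<dots>" by (intro open_INT finite_lessThan ballI open_Collect_less continuous_intros)
    ultimately show ?thesis using cells(1)[OF that] by (auto intro: open_Int)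
  qed
  have up: "x + r *\<^sub>R b m \<in> C i \<inter> {x. \<forall>j<k. aff (g j i) x < b m \<bullet> x}"
    if i: "length i = m" and x: "x \<in> C i \<inter> {x. \<forall>j<k. aff (g j i) x < b m \<bullet> x}" and r: "0 \<le> r" for i x r
  proof -
    have "aff (g j i) (x + r *\<^sub>R b m) = aff (g j i) x" if "j < k" for j
      using yao_yao_in_initial_affine[OF Y g(1)[OF that] i] m by (intro aff_shift) auto
    then show ?thesis
      using x r cells(3)[OF i order_refl m] m by (fastforce simp: inner_add_right inner_frame)
  qed
  \<comment> \<open>Since \<open>Suc k \<le> t\<close>, at least two shares are left before this
    cut.\<close>
  have less: "\<beta> i < measure M (C i \<inter> {x. \<forall>j<k. aff (g j i) x < b m \<bullet> x})" if "length i = m" for i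
  proof -
    have "1 * \<beta> i < real (t + 1 - k) * \<beta> i"
      using \<beta>[OF that] Suc.prems by (intro mult_strict_right_mono) auto
    then show ?thesis using g(3)[OF that] by simp
  qed
  obtain h where h: "h \<in> L"
    "\<And>i. length i = m \<Longrightarrow> measure M (C i \<inter> {x. \<forall>j<k. aff (g j i) x < b m \<bullet> x} \<inter> {x. b m \<bullet> x < aff (h i) x}) = \<beta> i"
    "\<And>i. length i = m \<Longrightarrow> measure M (C i \<inter> {x. \<forall>j<k. aff (g j i) x < b m \<bullet> x} \<inter> {x. aff (h i) x < b m \<bullet> x})
       = measure M (C i \<inter> {x. \<forall>j<k. aff (g j i) x < b m \<bullet> x}) - \<beta> i"
    by (rule yao_yao_cut[OF Y m open_U Int_lower1 up \<beta> less]) blast+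
  show ?case
  proof (intro exI[of _ "g(k := h)"] conjI allI impI)
    fix l assume "l < Suc k"
    then show "(g(k := h)) l \<in> L" using g(1) h(1) by (auto simp: less_Suc_eq)
  next
    fix i :: "bool list" and l assume i: "length i = m" and l: "l < Suc k"
    then show "measure M (C i \<inter> {x. \<forall>j<l. aff ((g(k := h)) j i) x < b m \<bullet> x} \<inter> {x. b m \<bullet> x < aff ((g(k := h)) l i) x})
      = measure M (C i) / real (t + 1)"
      using g(2)[OF i, of l] h(2)[OF i] unfolding \<beta>_def[symmetric]
      by (cases "l = k") (auto cong: conj_cong)
  next
    fix i :: "bool list" assume i: "length i = m"
    have "C i \<inter> {x. \<forall>j<Suc k. aff ((g(k := h)) j i) x < b m \<bullet> x} =
      C i \<inter> {x. \<forall>j<k. aff (g j i) x < b m \<bullet> x} \<inter> {x. aff (h i) x < b m \<bullet> x}"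
      by (auto simp: less_Suc_eq)
    then show "measure M (C i \<inter> {x. \<forall>j<Suc k. aff ((g(k := h)) j i) x < b m \<bullet> x}) =
      real (t + 1 - Suc k) * (measure M (C i) / real (t + 1))"
      using h(3)[OF i] g(3)[OF i] Suc.prems unfolding \<beta>_def[symmetric] by (simp add: of_nat_diff algebra_simps)
  qed
qed

end

section \<open>The partition for a positive measure and the count of missed regions\<close>

lemma card_bool_lists: "card {i :: bool list. length i = m} = 2 ^ m"
  using card_lists_length_eq[of "UNIV :: bool set" m] by simp

lemma finite_bool_lists: "finite {i :: bool list. length i = m}"
  using finite_lists_length_eq[of "UNIV :: bool set" m] by simp

context yao_yao_measure
begin

text \<open>Regions are indexed by a cell and a slab over it. They are open, with strict cuts, so
  disjointness is literal; that their closures cover the space is derived later from their total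
  mass.\<close>

lemma equal_partition_of_positive:
  fixes t :: nat
  defines "J \<equiv> {i :: bool list. length i = DIM('a) - 1} \<times> {..t}"
  shows "\<exists>R. (\<forall>j\<in>J. open (R j) \<and> convex (R j) \<and> measure M (R j) = measure M UNIV / card J) \<and>
    disjoint_family_on R J \<and> (\<forall>H. hyperplane H \<longrightarrow> t \<le> card {j\<in>J. H \<inter> R j = {}})"
proof -
  define m where "m = DIM('a) - 1"
  have m: "m < DIM('a)" by (simp add: m_def)
  obtain C L where Y: "yao_yao m C L"
    and C: "\<And>i. length i = m \<Longrightarrow> measure M (C i) = measure M UNIV / 2 ^ m"
    using yao_yao_exists[OF m] by blast
  have pos: "0 < measure M (C i)" if "length i = m" for i
    using C[OF that] measure_UNIV_pos by simp
  obtain g where gL: "\<And>l. l < t \<Longrightarrow> g l \<in> L"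
    and g: "\<And>i l. length i = m \<Longrightarrow> l < t \<Longrightarrow>
      measure M (C i \<inter> {x. \<forall>j<l. aff (g j i) x < b m \<bullet> x} \<inter> {x. b m \<bullet> x < aff (g l i) x})
           = measure M (C i) / real (t + 1)"
    and gt: "\<And>i. length i = m \<Longrightarrow>
      measure M (C i \<inter> {x. \<forall>j<t. aff (g j i) x < b m \<bullet> x}) = measure M (C i) / real (t + 1)"
    using yao_yao_cuts[OF Y m pos order_refl, of t] by auto
  \<comment> \<open>Slab \<open>l\<close> lies above the cuts before \<open>l\<close> and below cut
    \<open>l\<close>; the implication leaves the top slab \<open>l = t\<close> unbounded
    above.\<close>
  define R where "R = (\<lambda>(i, l). C i \<inter> {x. \<forall>j<l. aff (g j i) x < b m \<bullet> x} \<inter> {x. l < t \<longrightarrow> b m \<bullet> x < aff (g l i) x})"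
  note cells = yao_yao_cells[OF Y _ less_imp_le[OF m]]
  have J: "J = {i. length i = m} \<times> {..t}" by (simp add: J_def m_def)
  have cardJ: "card J = 2 ^ m * (t + 1)" by (simp add: J card_cartesian_product card_bool_lists)
  have finJ: "finite J" unfolding J by (intro finite_cartesian_product finite_bool_lists finite_atMost)
  have meas: "measure M (R (i, l)) = measure M UNIV / card J" if "length i = m" "l \<le> t" for i l
    using g[OF that(1), of l] gt[OF that(1)] C[OF that(1)] that
    unfolding cardJ R_def by (cases "l = t") (auto simp: field_simps)
  have half: "open {x. aff p x < b m \<bullet> x}" "convex {x. aff p x < b m \<bullet> x}"
    "open {x. b m \<bullet> x < aff p x}" "convex {x. b m \<bullet> x < aff p x}" for p
  proof -
    have "{x. aff p x < b m \<bullet> x} = {x. (b m - fst p) \<bullet> x > snd p}"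
      "{x. b m \<bullet> x < aff p x} = {x. (b m - fst p) \<bullet> x < snd p}"
      by (auto simp: aff_def inner_diff_left)
    then show "open {x. aff p x < b m \<bullet> x}" "convex {x. aff p x < b m \<bullet> x}"
      "open {x. b m \<bullet> x < aff p x}" "convex {x. b m \<bullet> x < aff p x}"
      by (simp_all add: open_halfspace_gt open_halfspace_lt convex_halfspace_gt convex_halfspace_lt)
  qed
  have oc: "open (R (i, l)) \<and> convex (R (i, l))" if i: "length i = m" for i l
  proof -
    have "R (i, l) = C i \<inter> (\<Inter>j\<in>{..<l}. {x. aff (g j i) x < b m \<bullet> x}) \<inter> (if l < t then {x. b m \<bullet> x < aff (g l i) x} else UNIV)"
      by (auto simp: R_def)
    then show ?thesis
      using cells(1,2)[OF i] by (auto intro!: half convex_Int convex_INT)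
  qed
  have less: "R (i, l) \<inter> R (i, l') = {}" if "l < l'" "l' \<le> t" for i l l'
    using that by (fastforce simp: R_def)
  have disj: "R (i, l) \<inter> R (i', l') = {}"
    if "length i = m" "length i' = m" "l \<le> t" "l' \<le> t" "(i, l) \<noteq> (i', l')" for i i' l l'
  proof (cases "i = i'")
    case True
    then show ?thesis using less[of l l' i] less[of l' l i] that by (cases l l' rule: linorder_cases) auto
  next
    case False
    then have "C i \<inter> C i' = {}" using yao_yao_disjoint[OF Y] that by simp
    then show ?thesis by (auto simp: R_def)
  qed
  have Rne: "R (i, l) \<noteq> {}" if "length i = m" "l \<le> t" for i l
  proof
    assume "R (i, l) = {}"
    then have "measure M UNIV / card J = 0" using meas[OF that] by simp
    moreover have "0 < card J" unfolding cardJ by simp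
    ultimately show False using measure_UNIV_pos by simp
  qed
  obtain z where z: "\<And>\<phi>. \<phi> \<in> L \<Longrightarrow> \<exists>c. (\<forall>i. length i = m \<longrightarrow> aff (\<phi> i) z = c) \<and>
    (0 \<le> c \<longrightarrow> (\<exists>i. length i = m \<and> (\<forall>x\<in>C i. 0 \<le> aff (\<phi> i) x)))"
    using yao_yao_center[OF Y less_imp_le[OF m]] by blast
  \<comment> \<open>An element of \<open>L\<close> has the same value at \<open>z\<close> on all
    cells, so an arbitrary index serves to read it off.\<close>
  define i0 where "i0 = replicate m True"
  have i0: "length i0 = m" by (simp add: i0_def)
  have cmp: "\<exists>i. length i = m \<and> (\<forall>x\<in>C i. aff (\<psi> i) x \<le> aff (\<phi> i) x)"
    if "\<phi> \<in> L" "\<psi> \<in> L" "aff (\<psi> i0) z \<le> aff (\<phi> i0) z" for \<phi> \<psi>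
    using z[OF yao_yao_diff[OF Y that(1,2)]] i0 that(3) by (auto simp: aff_diff)
  \<comment> \<open>Otherwise the slab between consecutive cuts would be empty over some cell.\<close>
  have incr: "aff (g l i0) z \<le> aff (g (Suc l) i0) z" if l: "Suc l < t" for l
  proof (rule ccontr)
    assume "\<not> ?thesis"
    then obtain i where "length i = m" "\<forall>x\<in>C i. aff (g (Suc l) i) x \<le> aff (g l i) x"
      using cmp[of "g l" "g (Suc l)"] gL l by auto
    then have "R (i, Suc l) = {}" using l by (fastforce simp: R_def)
    then show False using Rne[OF \<open>length i = m\<close>, of "Suc l"] l by simp
  qed
  have miss: "t \<le> card {j\<in>J. H \<inter> R j = {}}" if "hyperplane H" for H
  proof -
    obtain n c where n: "n \<noteq> 0" and H: "H = {x. n \<bullet> x = c}"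
      using \<open>hyperplane H\<close> unfolding hyperplane_def by blast
    have fin: "finite {j\<in>J. H \<inter> R j = {}}" using finJ by simp
    show ?thesis
    proof (cases "n \<bullet> b m = 0")
      case True
      \<comment> \<open>\<open>H\<close> contains the direction \<open>b m\<close>, so its defining
        function involves only the first \<open>m\<close> coordinates. Comparison with 0 puts an
        entire cell on one closed side of \<open>H\<close>.\<close>
      have "(n, - c) \<in> initial_affine m"
      proof -
        have "k = m" if "m \<le> k" "k < DIM('a)" for k using that by (auto simp: m_def)
        then show ?thesis using True by (auto simp: initial_affine_def)
      qed
      then have "(\<lambda>_. (n, - c)) \<in> L" "(\<lambda>_. - (n, - c)) \<in> L"
        using yao_yao_affine[OF Y less_imp_le[OF m]] subspace_neg[OF subspace_initial_affine] by blast+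
      moreover have "0 \<in> initial_affine m" by (rule subspace_0[OF subspace_initial_affine])
      then have "(\<lambda>_. 0) \<in> L" using yao_yao_affine[OF Y less_imp_le[OF m]] by blast
      ultimately obtain i where i: "length i = m"
        and "(\<forall>x\<in>C i. 0 \<le> aff (n, - c) x) \<or> (\<forall>x\<in>C i. aff (n, - c) x \<le> 0)"
        using cmp[of "\<lambda>_. (n, - c)" "\<lambda>_. 0"] cmp[of "\<lambda>_. 0" "\<lambda>_. (n, - c)"]
        by (cases "aff (n, - c) z \<le> 0") (auto simp: aff_def)
      then have "C i \<subseteq> {x. n \<bullet> x \<ge> c} \<or> C i \<subseteq> {x. n \<bullet> x \<le> c}" by (auto simp: aff_def)
      \<comment> \<open>An open set in a closed half-space lies in its interior, hence off the
        bounding hyperplane.\<close>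
      then have "C i \<subseteq> interior {x. n \<bullet> x \<ge> c} \<or> C i \<subseteq> interior {x. n \<bullet> x \<le> c}"
        using interior_maximal cells(1)[OF i] by metis
      then have "C i \<inter> H = {}" using n by (auto simp: H)
      then have "{i} \<times> {..t} \<subseteq> {j\<in>J. H \<inter> R j = {}}" using i by (auto simp: J R_def)
      from card_mono[OF fin this] show ?thesis by (simp add: card_cartesian_product)
    next
      case False
      \<comment> \<open>The equation of \<open>H\<close> solved for the coordinate along
        \<open>b m\<close>.\<close>
      define h where "h = ((-1 / (n \<bullet> b m)) *\<^sub>R (n - (n \<bullet> b m) *\<^sub>R b m), c / (n \<bullet> b m))"
      have Hh: "x \<in> H \<longleftrightarrow> b m \<bullet> x = aff h x" for x
        using False by (auto simp: H h_def aff_def inner_diff_left field_simps)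
      have "h \<in> initial_affine m"
      proof -
        have "k = m" if "m \<le> k" "k < DIM('a)" for k using that by (auto simp: m_def)
        moreover have "fst h \<bullet> b m = 0" using m by (simp add: h_def inner_diff_left inner_frame)
        ultimately show ?thesis unfolding initial_affine_def by blast
      qed
      then have hL: "(\<lambda>_. h) \<in> L" using yao_yao_affine[OF Y less_imp_le[OF m]] by blast
      \<comment> \<open>A cut passing below \<open>H\<close> at the centre yields a missed slab just below that cut, any other
        cut one just above it; monotonicity at the centre keeps these slabs distinct.\<close>
      define f where "f l = (if aff (g l i0) z \<le> aff h z then l else Suc l)" for l
      have "\<exists>i. length i = m \<and> H \<inter> R (i, f l) = {}" if l: "l < t" for l
      proof (cases "aff (g l i0) z \<le> aff h z")
        case True
        then obtain i where i: "length i = m" "\<forall>x\<in>C i. aff (g l i) x \<le> aff h x"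
          using cmp[OF hL gL[OF l]] by blast
        then have "H \<inter> R (i, l) = {}" using l by (fastforce simp: R_def Hh)
        then show ?thesis using i True by (auto simp: f_def)
      next
        case False
        then obtain i where i: "length i = m" "\<forall>x\<in>C i. aff h x \<le> aff (g l i) x"
          using cmp[OF gL[OF l] hL] by auto
        then have "H \<inter> R (i, Suc l) = {}" using l by (fastforce simp: R_def Hh)
        then show ?thesis using i False by (auto simp: f_def)
      qed
      then obtain I where I: "\<And>l. l < t \<Longrightarrow> length (I l) = m \<and> H \<inter> R (I l, f l) = {}" by metis
      \<comment> \<open>Since \<open>f l\<close> is \<open>l\<close> or \<open>Suc l\<close>, only
        adjacent cuts could collide: \<open>H\<close> would then pass below cut \<open>l\<close> and
        not below cut \<open>Suc l\<close> at the centre, contrary to \<open>incr\<close>.\<close>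
      have f_less: "f l < f l'" if "l < l'" "l' < t" for l l'
      proof (cases "l' = Suc l")
        case True
        then show ?thesis using incr[of l] that by (auto simp: f_def)
      next
        case False
        then show ?thesis using that by (auto simp: f_def)
      qed
      have "inj_on (\<lambda>l. (I l, f l)) {..<t}"
      proof (rule inj_onI)
        fix l l' assume "l \<in> {..<t}" "l' \<in> {..<t}" "(I l, f l) = (I l', f l')"
        then show "l = l'" using f_less[of l l'] f_less[of l' l] by (cases l l' rule: linorder_cases) auto
      qed
      moreover have "(\<lambda>l. (I l, f l)) ` {..<t} \<subseteq> {j\<in>J. H \<inter> R j = {}}"
        using I by (auto simp: J f_def)
      ultimately show ?thesis using card_inj_on_le[OF _ _ fin] by fastforce
    qed
  qed
  have "disjoint_family_on R J"
    using disj unfolding disjoint_family_on_def J by auto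
  then show ?thesis using oc meas miss unfolding J by (intro exI[of _ R]) auto
qed

end

section \<open>Passage to the limit\<close>

text \<open>The regions already carry the full mass, whereas an uncovered part would be open and
  nonempty and so add positive mass.\<close>

lemma disjoint_open_closure_cover:
  fixes R :: "'j \<Rightarrow> 'a::euclidean_space set"
  assumes "finite_measure M" "sets M = sets borel" "finite J" "J \<noteq> {}"
    and op: "\<And>j. j \<in> J \<Longrightarrow> open (R j)" and disj: "disjoint_family_on R J"
    and meas: "\<And>j. j \<in> J \<Longrightarrow> measure M (R j) = measure M UNIV / card J"
    and pos: "\<And>U. open U \<Longrightarrow> U \<noteq> {} \<Longrightarrow> 0 < measure M U"
  shows "(\<Union>j\<in>J. closure (R j)) = UNIV"
proof (rule ccontr)
  interpret finite_measure M by fact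
  assume ne: "(\<Union>j\<in>J. closure (R j)) \<noteq> UNIV"
  let ?V = "- (\<Union>j\<in>J. closure (R j))"
  have opV: "open ?V" using \<open>finite J\<close> by (intro open_Compl closed_UN) auto
  then have "0 < measure M ?V" using ne by (intro pos) auto
  moreover have "measure M (\<Union>j\<in>J. R j) = measure M UNIV"
    using finite_measure_finite_Union[OF \<open>finite J\<close> _ disj] op meas \<open>J \<noteq> {}\<close> \<open>finite J\<close> assms(2)
    by (auto simp: image_subset_iff)
  moreover have "measure M ((\<Union>j\<in>J. R j) \<union> ?V) = measure M (\<Union>j\<in>J. R j) + measure M ?V"
  proof (rule finite_measure_Union)
    show "(\<Union>j\<in>J. R j) \<in> sets M" "?V \<in> sets M"
      using op opV unfolding assms(2) by (auto intro!: borel_open)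
    show "(\<Union>j\<in>J. R j) \<inter> ?V = {}" using closure_subset by fastforce
  qed
  moreover have "measure M ((\<Union>j\<in>J. R j) \<union> ?V) \<le> measure M UNIV"
    using assms(2) by (intro finite_measure_mono) auto
  ultimately show False by simp
qed

lemma convex_eventually_mem:
  assumes Q: "\<And>n. convex (Q n)"
  shows "convex {s. \<forall>\<^sub>F n in F. s \<in> Q n}"
proof (rule convexI, unfold mem_Collect_eq)
  fix p q and u v :: real
  assume uv: "0 \<le> u" "0 \<le> v" "u + v = 1"
  assume "\<forall>\<^sub>F n in F. p \<in> Q n" "\<forall>\<^sub>F n in F. q \<in> Q n"
  then show "\<forall>\<^sub>F n in F. u *\<^sub>R p + v *\<^sub>R q \<in> Q n"
    by eventually_elim (use uv Q in \<open>auto intro: convexD\<close>)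
qed

text \<open>A cube around \<open>x\<close> is the hull of finitely many points. These eventually lie
  in \<open>Q n\<close> simultaneously, and by convexity so does the cube.\<close>

lemma interior_eventually:
  fixes Q :: "nat \<Rightarrow> 'a::euclidean_space set"
  assumes Q: "\<And>n. convex (Q n)"
    and x: "x \<in> interior (closure {s. \<forall>\<^sub>F n in sequentially. s \<in> Q n})"
  shows "\<forall>\<^sub>F n in sequentially. x \<in> interior (Q n)"
proof -
  let ?E = "{s. \<forall>\<^sub>F n in sequentially. s \<in> Q n}"
  have "convex ?E" by (rule convex_eventually_mem[OF Q])
  then have "x \<in> interior ?E" using x by (simp add: convex_interior_closure)
  then obtain e where e: "0 < e" "cball x e \<subseteq> ?E" by (auto simp: mem_interior_cball)
  \<comment> \<open>With this half-width the sum of the coordinate differences is at most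
    \<open>e\<close>, so the cube fits into the ball.\<close>
  define d where "d = e / DIM('a)"
  have d: "0 < d" using e by (simp add: d_def)
  let ?box = "cbox (x - (\<Sum>i\<in>Basis. d *\<^sub>R i)) (x + (\<Sum>i\<in>Basis. d *\<^sub>R i))"
  obtain F where F: "finite F" "?box = convex hull F" using cube_convex_hull[OF d] .
  have "?box \<subseteq> cball x e"
  proof
    fix y assume y: "y \<in> ?box"
    have "\<bar>(y - x) \<bullet> i\<bar> \<le> d" if "i \<in> Basis" for i
      using y that by (auto simp: mem_box algebra_simps abs_le_iff inner_sum_left inner_Basis if_distrib cong: if_cong)
    then have "norm (y - x) \<le> (\<Sum>i\<in>(Basis::'a set). d)"
      by (intro order_trans[OF norm_le_l1] sum_mono)
    then show "y \<in> cball x e" by (simp add: d_def dist_norm norm_minus_commute)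
  qed
  then have "F \<subseteq> ?E" using e F hull_subset[of F convex] by auto
  then have "\<forall>\<^sub>F n in sequentially. \<forall>s\<in>F. s \<in> Q n"
    using F(1) by (auto intro!: eventually_ball_finite)
  then show ?thesis
  proof eventually_elim
    case (elim n)
    then have "?box \<subseteq> Q n" unfolding F(2) using Q by (intro hull_minimal) auto
    moreover have "x \<in> box (x - (\<Sum>i\<in>Basis. d *\<^sub>R i)) (x + (\<Sum>i\<in>Basis. d *\<^sub>R i))"
      using d by (auto simp: mem_box algebra_simps inner_sum_left inner_Basis if_distrib cong: if_cong)
    ultimately show ?case
      using interior_mono interior_cbox by blast
  qed
qed

text \<open>Along a diagonal subsequence, membership stabilises on a countable dense set;
  \<open>K j\<close> is the closure of the points eventually in region \<open>j\<close>. By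
  convexity interior points of \<open>K j\<close> eventually lie in the open region, which transfers
  disjointness, masses and missed regions.\<close>

lemma equal_partition_limit:
  fixes \<mu> :: "'a::euclidean_space measure" and R :: "nat \<Rightarrow> 'j \<Rightarrow> 'a set"
  assumes "finite_measure \<mu>" and sets_\<mu>: "sets \<mu> = sets borel" and ac: "absolutely_continuous lborel \<mu>"
    and pos: "0 < measure \<mu> UNIV" and finJ: "finite J"
    and op: "\<And>n j. j \<in> J \<Longrightarrow> open (R n j)" and conv: "\<And>n j. j \<in> J \<Longrightarrow> convex (R n j)"
    and disj: "\<And>n. disjoint_family_on (R n) J"
    and cover: "\<And>n. (\<Union>j\<in>J. closure (R n j)) = UNIV"
    and lim: "\<And>j. j \<in> J \<Longrightarrow> (\<lambda>n. measure \<mu> (R n j)) \<longlonglongrightarrow> measure \<mu> UNIV / card J"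
    and miss: "\<And>n H. hyperplane H \<Longrightarrow> t \<le> card {j\<in>J. H \<inter> R n j = {}}"
  shows "\<exists>P. convex_partition P \<and> card P = card J \<and>
    (\<forall>C\<in>P. \<forall>D\<in>P. emeasure \<mu> C = emeasure \<mu> D) \<and>
    (\<forall>H. hyperplane H \<longrightarrow> t \<le> card {C \<in> P. avoids_interior H C})"
proof -
  interpret finite_measure \<mu> by fact
  obtain D :: "'a set" where D: "countable D" "\<And>X. open X \<Longrightarrow> X \<noteq> {} \<Longrightarrow> \<exists>d\<in>D. d \<in> X"
    using countable_dense_exists by blast
  have "countable (J \<times> D)" using D finJ by (simp add: countable_finite)
  \<comment> \<open>Indicators are bounded, so one subsequence makes them converge for all of the
    countably many pairs; a convergent sequence of zeros and ones is eventually constant.\<close>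
  then obtain k where k: "strict_mono k"
    and conv_k: "\<And>p. p \<in> J \<times> D \<Longrightarrow> \<exists>l. (\<lambda>n. indicat_real (closure (R (k n) (fst p))) (snd p)) \<longlonglongrightarrow> l"
    using function_convergent_subsequence[of "J \<times> D"
        "\<lambda>n p. indicat_real (closure (R n (fst p))) (snd p)" 1]
    by (auto simp: indicator_def)
  define Q where "Q n j = closure (R (k n) j)" for n j
  define K where "K j = closure {s. \<forall>\<^sub>F n in sequentially. s \<in> Q n j}" for j
  have convQ: "convex (Q n j)" if "j \<in> J" for n j
    using conv[OF that] by (simp add: Q_def convex_closure)
  have intQ: "interior (Q n j) = R (k n) j" if "j \<in> J" for n j
    using conv[OF that] op[OF that] by (simp add: Q_def convex_interior_closure interior_open)
  have ev: "\<forall>\<^sub>F n in sequentially. x \<in> R (k n) j" if "j \<in> J" "x \<in> interior (K j)" for j x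
    using interior_eventually[of "\<lambda>n. Q n j" x] that convQ intQ by (simp add: K_def)
  have convK: "convex (K j)" if "j \<in> J" for j
    unfolding K_def by (intro convex_closure convex_eventually_mem convQ that)
  have coverD: "D \<subseteq> (\<Union>j\<in>J. K j)"
  proof
    fix q assume q: "q \<in> D"
    show "q \<in> (\<Union>j\<in>J. K j)"
    proof (rule ccontr)
      assume nq: "q \<notin> (\<Union>j\<in>J. K j)"
      have "\<forall>\<^sub>F n in sequentially. q \<notin> Q n j" if j: "j \<in> J" for j
      proof -
        obtain l where l: "(\<lambda>n. indicat_real (Q n j) q) \<longlonglongrightarrow> l"
          using conv_k[of "(j, q)"] q j by (auto simp: Q_def)
        have "\<not> 0 < l"
        proof
          assume "0 < l"
          with l have "\<forall>\<^sub>F n in sequentially. 0 < indicat_real (Q n j) q" by (rule order_tendstoD)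
          then have "\<forall>\<^sub>F n in sequentially. q \<in> Q n j"
            by eventually_elim (auto simp: indicator_def split: if_splits)
          then have "q \<in> K j" using closure_subset[of "{s. \<forall>\<^sub>F n in sequentially. s \<in> Q n j}"] by (auto simp: K_def)
          then show False using nq j by blast
        qed
        then have "\<forall>\<^sub>F n in sequentially. indicat_real (Q n j) q < 1"
          by (intro order_tendstoD(2)[OF l]) simp
        then show ?thesis by eventually_elim (auto simp: indicator_def split: if_splits)
      qed
      then have "\<forall>\<^sub>F n in sequentially. \<forall>j\<in>J. q \<notin> Q n j"
        using finJ by (simp add: eventually_ball_finite)
      then obtain n where "\<forall>j\<in>J. q \<notin> Q n j" by (auto dest!: eventually_happens)
      then show False using cover[of "k n"] by (auto simp: Q_def)
    qed
  qed
  have closedK: "closed (K j)" for j by (simp add: K_def)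
  have coverK: "(\<Union>j\<in>J. K j) = UNIV"
  proof (rule ccontr)
    assume "(\<Union>j\<in>J. K j) \<noteq> UNIV"
    moreover have "open (- (\<Union>j\<in>J. K j))" using finJ closedK by (intro open_Compl closed_UN) auto
    ultimately obtain d where "d \<in> D" "d \<in> - (\<Union>j\<in>J. K j)"
      using D(2)[of "- (\<Union>j\<in>J. K j)"] by auto
    then show False using coverD by blast
  qed
  have disjK: "interior (K i) \<inter> interior (K j) = {}" if ij: "i \<in> J" "j \<in> J" "i \<noteq> j" for i j
  proof (rule ccontr)
    assume "\<not> ?thesis"
    then obtain x where "x \<in> interior (K i)" "x \<in> interior (K j)" by blast
    then have "\<forall>\<^sub>F n in sequentially. x \<in> R (k n) i \<and> x \<in> R (k n) j"
      using ev ij by (simp add: eventually_conj)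
    then obtain n where "x \<in> R (k n) i" "x \<in> R (k n) j" by (auto dest!: eventually_happens)
    then show False using disj[of "k n"] ij by (auto simp: disjoint_family_on_def)
  qed
  have null: "frontier (K j) \<in> null_sets \<mu>" if "j \<in> J" for j
    using convK[OF that] by (intro null_sets_of_negligible[OF ac] negligible_convex_frontier borel_closed frontier_closed)
  have "AE x in \<mu>. \<forall>j\<in>J. x \<notin> frontier (K j)"
    using finJ null by (intro AE_finite_allI AE_not_in) auto
  \<comment> \<open>Off the null frontiers \<open>x\<close> is interior to some \<open>K i\<close>,
    hence eventually in region \<open>i\<close> and, by disjointness, in no other region.\<close>
  then have ae: "AE x in \<mu>. \<forall>\<^sub>F n in sequentially. x \<in> R (k n) j \<longleftrightarrow> x \<in> K j" if j: "j \<in> J" for j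
  proof eventually_elim
    case (elim x)
    obtain i where i: "i \<in> J" "x \<in> K i" using coverK by blast
    have int: "x \<in> interior (K l)" if "l \<in> J" "x \<in> K l" for l
      using elim that closedK[of l] by (auto simp: frontier_def closure_closed)
    have evi: "\<forall>\<^sub>F n in sequentially. x \<in> R (k n) i" using ev i int by blast
    show ?case
    proof (cases "i = j")
      case True
      then show ?thesis using evi i by (auto elim!: eventually_mono)
    next
      case False
      then have "x \<notin> K j" using int i j disjK by blast
      with evi show ?thesis
        using False disj i j by (fastforce simp: disjoint_family_on_def elim!: eventually_mono)
    qed
  qed
  have measK: "measure \<mu> (K j) = measure \<mu> UNIV / card J" if j: "j \<in> J" for j
  proof -
    have "(\<lambda>n. measure \<mu> (R (k n) j)) \<longlonglongrightarrow> measure \<mu> (K j)"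
      using op[OF j] closedK by (intro measure_tendsto_of_AE ae j) (auto simp: sets_\<mu>)
    moreover have "(\<lambda>n. measure \<mu> (R (k n) j)) \<longlonglongrightarrow> measure \<mu> UNIV / card J"
      using LIMSEQ_subseq_LIMSEQ[OF lim[OF j] k] by (simp add: o_def)
    ultimately show ?thesis by (rule LIMSEQ_unique)
  qed
  \<comment> \<open>Coinciding limits would have empty interior, so equal their null frontier,
    against their positive share. This keeps the number of regions.\<close>
  have inj: "inj_on K J"
  proof (rule inj_onI, rule ccontr)
    fix i j assume ij: "i \<in> J" "j \<in> J" "K i = K j" "i \<noteq> j"
    then have "interior (K i) = {}" using disjK[of i j] by auto
    then have "frontier (K i) = K i" using closedK[of i] by (simp add: frontier_def closure_closed)
    then have "measure \<mu> (K i) = 0" using null[OF ij(1)] by (auto simp: null_sets_def measure_def)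
    moreover have "0 < card J" using ij finJ by (auto simp: card_gt_0_iff)
    ultimately show False using measK[OF ij(1)] pos by simp
  qed
  have "t \<le> card {C \<in> K ` J. avoids_interior H C}" if H: "hyperplane H" for H
  proof -
    let ?B = "{j\<in>J. H \<inter> interior (K j) \<noteq> {}}"
    \<comment> \<open>One witness is chosen in each interior met by \<open>H\<close>. For some
      \<open>n\<close> all these finitely many witnesses lie in the approximating regions, so what
      \<open>H\<close> misses there it misses in the limit.\<close>
    have "\<forall>j\<in>?B. \<exists>y. y \<in> H \<inter> interior (K j)" by auto
    then obtain x where x: "\<And>j. j \<in> ?B \<Longrightarrow> x j \<in> H \<inter> interior (K j)"
      using bchoice[of ?B "\<lambda>j y. y \<in> H \<inter> interior (K j)"] by blast
    have "\<forall>\<^sub>F n in sequentially. \<forall>j\<in>?B. x j \<in> R (k n) j"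
      using finJ x ev by (intro eventually_ball_finite) auto
    then obtain n where n: "\<forall>j\<in>?B. x j \<in> R (k n) j" by (auto dest!: eventually_happens)
    have "{j\<in>J. H \<inter> R (k n) j = {}} \<subseteq> {j\<in>J. avoids_interior H (K j)}"
      using n x unfolding avoids_interior_def by blast
    then have "card {j\<in>J. H \<inter> R (k n) j = {}} \<le> card {j\<in>J. avoids_interior H (K j)}"
      using finJ by (intro card_mono) auto
    also have "\<dots> = card (K ` {j\<in>J. avoids_interior H (K j)})"
      using inj by (intro card_image[symmetric]) (auto simp: inj_on_def)
    also have "K ` {j\<in>J. avoids_interior H (K j)} = {C \<in> K ` J. avoids_interior H C}" by auto
    finally show ?thesis using miss[OF H, of "k n"] by linarith
  qed
  moreover have "convex_partition (K ` J)"
    unfolding convex_partition_def disjoint_family_on_def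
    using finJ closedK convK coverK by (auto, use disjK in \<open>blast+\<close>)
  moreover have "card (K ` J) = card J" using inj by (rule card_image)
  moreover have "emeasure \<mu> C = emeasure \<mu> C'" if "C \<in> K ` J" "C' \<in> K ` J" for C C'
    using that by (auto simp: emeasure_eq_measure measK)
  ultimately show ?thesis by blast
qed

section \<open>Perturbation by a positive density, and the general case\<close>

lemma exists_positive_finite_density:
  obtains h :: "'a::euclidean_space \<Rightarrow> ennreal"
  where "h \<in> borel_measurable borel" "integral\<^sup>N lborel h \<noteq> \<infinity>" "\<And>x. 0 < h x"
  using sigma_finite_measure.Ex_finite_integrable_function[OF sigma_finite_lborel] by auto

text \<open>As \<open>f\<close> is positive everywhere, an open set null for the density would be
  Lebesgue null, hence empty.\<close>

lemma density_positive_measure: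
  fixes f :: "'a::euclidean_space \<Rightarrow> ennreal"
  assumes [measurable]: "f \<in> borel_measurable borel" and fin: "integral\<^sup>N lborel f \<noteq> \<infinity>" and pos: "\<And>x. 0 < f x"
    and b: "coordinate_frame b"
  shows "yao_yao_measure b (density lborel f)"
proof -
  interpret coordinate_frame b by fact
  interpret finite_measure "density lborel f"
    by (rule finite_measureI) (use fin in \<open>simp add: emeasure_density\<close>)
  show ?thesis
  proof
    show "sets (density lborel f) = sets borel" by simp
    show "absolutely_continuous lborel (density lborel f)" by (rule absolutely_continuousI_density) simp
    fix U :: "'a set" assume U: "open U" "U \<noteq> {}"
    have "emeasure (density lborel f) U \<noteq> 0"
    proof
      assume "emeasure (density lborel f) U = 0"
      then have "AE x in lborel. x \<in> U \<longrightarrow> f x = 0"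
        using U null_sets_density_iff[of f lborel U] by (auto simp: null_sets_def)
      then have "AE x in lborel. x \<notin> U"
        by eventually_elim (use pos in \<open>metis less_irrefl\<close>)
      then have "U \<in> null_sets lborel" using U by (subst AE_iff_null_sets) auto
      then have "negligible U" using null_sets_completionI by (auto simp: negligible_iff_null_sets)
      then show False using open_not_negligible U by blast
    qed
    then show "0 < measure (density lborel f) U"
      by (simp add: emeasure_eq_measure zero_less_measure_iff)
  qed
qed

lemma exists_frame: "\<exists>b :: nat \<Rightarrow> 'a::euclidean_space. coordinate_frame b"
  using ex_bij_betw_nat_finite[OF finite_Basis]
  by (auto simp: coordinate_frame_def atLeast0LessThan)

lemma equal_partition_exists:
  fixes \<mu> :: "'a::euclidean_space measure"
  assumes "finite_measure \<mu>" and sets_\<mu>: "sets \<mu> = sets borel" and ac: "absolutely_continuous lborel \<mu>"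
    and pos: "0 < measure \<mu> UNIV"
  shows "\<exists>P. convex_partition P \<and> card P = (t + 1) * 2 ^ (DIM('a) - 1) \<and>
    (\<forall>C\<in>P. \<forall>D\<in>P. emeasure \<mu> C = emeasure \<mu> D) \<and>
    (\<forall>H. hyperplane H \<longrightarrow> t \<le> card {C \<in> P. avoids_interior H C})"
proof -
  interpret finite_measure \<mu> by fact
  obtain b :: "nat \<Rightarrow> 'a" where b: "coordinate_frame b" using exists_frame by blast
  obtain h :: "'a \<Rightarrow> ennreal" where [measurable]: "h \<in> borel_measurable borel"
    and h: "integral\<^sup>N lborel h \<noteq> \<infinity>" "\<And>x. 0 < h x"
    using exists_positive_finite_density by blast
  define f where "f = RN_deriv lborel \<mu>"
  have [measurable]: "f \<in> borel_measurable borel" unfolding f_def by simp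
  have f: "density lborel f = \<mu>" unfolding f_def by (rule sigma_finite_measure.density_RN_deriv[OF sigma_finite_lborel]) (use ac sets_\<mu> in auto)
  \<comment> \<open>The Radon-Nikodym density plus a vanishing multiple of a positive one;
    \<open>Suc n\<close> keeps the factor defined at \<open>n = 0\<close>.\<close>
  define F where "F n x = f x + ennreal (1 / Suc n) * h x" for n :: nat and x
  define M where "M n = density lborel (F n)" for n
  define N where "N = density lborel h"
  have [measurable]: "F n \<in> borel_measurable borel" for n unfolding F_def by measurable
  have eM: "emeasure (M n) A = emeasure \<mu> A + ennreal (1 / Suc n) * emeasure N A" if [measurable]: "A \<in> sets borel" for n A
  proof -
    have "emeasure (M n) A = (\<integral>\<^sup>+x. f x * indicator A x + ennreal (1 / Suc n) * (h x * indicator A x) \<partial>lborel)"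
      by (simp add: M_def emeasure_density F_def algebra_simps)
    also have "\<dots> = (\<integral>\<^sup>+x. f x * indicator A x \<partial>lborel) + ennreal (1 / Suc n) * (\<integral>\<^sup>+x. h x * indicator A x \<partial>lborel)"
      by (subst nn_integral_add) (auto simp: nn_integral_cmult)
    finally show ?thesis by (simp add: f[symmetric] N_def emeasure_density)
  qed
  interpret N: finite_measure N
    by (rule finite_measureI) (use h in \<open>simp add: N_def emeasure_density\<close>)
  have YM: "yao_yao_measure b (M n)" for n
    unfolding M_def
  proof (rule density_positive_measure[OF _ _ _ b])
    have "integral\<^sup>N lborel (F n) = emeasure (M n) UNIV"
      by (simp add: M_def emeasure_density)
    also have "\<dots> < \<infinity>"
      by (subst eM) (auto simp: emeasure_eq_measure N.emeasure_eq_measure ennreal_mult_less_top)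
    finally show "integral\<^sup>N lborel (F n) \<noteq> \<infinity>" by simp
    show "0 < F n x" for x using h(2)[of x] by (auto simp: F_def zero_less_iff_neq_zero)
  qed simp
  have mM: "measure (M n) A = measure \<mu> A + 1 / Suc n * measure N A" if "A \<in> sets borel" for n A
    using eM[OF that, of n] unfolding measure_def
    by (subst eM[OF that])
      (simp add: enn2real_plus enn2real_mult emeasure_eq_measure N.emeasure_eq_measure ennreal_mult_less_top)
  define J where "J = {i :: bool list. length i = DIM('a) - 1} \<times> {..t}"
  have finJ: "finite J" unfolding J_def by (intro finite_cartesian_product finite_bool_lists finite_atMost)
  have cardJ: "card J = (t + 1) * 2 ^ (DIM('a) - 1)"
    by (simp add: J_def card_cartesian_product card_bool_lists)
  then have Jne: "J \<noteq> {}" by auto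
  have "\<forall>n. \<exists>R. (\<forall>j\<in>J. open (R j) \<and> convex (R j) \<and> measure (M n) (R j) = measure (M n) UNIV / card J) \<and>
    disjoint_family_on R J \<and> (\<forall>H. hyperplane H \<longrightarrow> t \<le> card {j\<in>J. H \<inter> R j = {}})"
    using yao_yao_measure.equal_partition_of_positive[OF YM] unfolding J_def by blast
  from choice[OF this] obtain R where
    "\<forall>n. (\<forall>j\<in>J. open (R n j) \<and> convex (R n j) \<and> measure (M n) (R n j) = measure (M n) UNIV / card J) \<and>
      disjoint_family_on (R n) J \<and> (\<forall>H. hyperplane H \<longrightarrow> t \<le> card {j\<in>J. H \<inter> R n j = {}})" ..
  then have R: "\<And>n j. j \<in> J \<Longrightarrow> open (R n j)" "\<And>n j. j \<in> J \<Longrightarrow> convex (R n j)"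
    "\<And>n j. j \<in> J \<Longrightarrow> measure (M n) (R n j) = measure (M n) UNIV / card J"
    "\<And>n. disjoint_family_on (R n) J"
    "\<And>n H. hyperplane H \<Longrightarrow> t \<le> card {j\<in>J. H \<inter> R n j = {}}"
    by auto
  have lim: "(\<lambda>n. measure \<mu> (R n j)) \<longlonglongrightarrow> measure \<mu> UNIV / card J" if j: "j \<in> J" for j
  proof -
    \<comment> \<open>This is the deviation of the \<mu>-mass of region \<open>j\<close> from the
      equal share: the factor \<open>1 / Suc n\<close> times a bounded quantity.\<close>
    have "(\<lambda>n. (1 / Suc n) * (measure N UNIV / card J - measure N (R n j))) \<longlonglongrightarrow> 0"
    proof (rule Lim_null_comparison)
      show "(\<lambda>n. (1 / Suc n) * (measure N UNIV / card J + measure N UNIV)) \<longlonglongrightarrow> 0"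
        by (intro tendsto_mult_left_zero LIMSEQ_Suc lim_1_over_n)
      have "\<bar>measure N UNIV / card J - measure N (R n j)\<bar> \<le> measure N UNIV / card J + measure N UNIV" for n
      proof -
        have "measure N (R n j) \<le> measure N UNIV" using N.bounded_measure[of "R n j"] by (simp add: N_def)
        moreover have "0 \<le> measure N UNIV / card J" "0 \<le> measure N (R n j)" by simp_all
        ultimately show ?thesis by linarith
      qed
      then show "\<forall>\<^sub>F n in sequentially. norm ((1 / Suc n) * (measure N UNIV / card J - measure N (R n j)))
          \<le> (1 / Suc n) * (measure N UNIV / card J + measure N UNIV)"
        by (intro always_eventually allI) (simp add: abs_mult divide_right_mono)
    qed
    then have "(\<lambda>n. measure \<mu> UNIV / card J + (1 / Suc n) * (measure N UNIV / card J - measure N (R n j)))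
        \<longlonglongrightarrow> measure \<mu> UNIV / card J + 0"
      by (intro tendsto_add tendsto_const)
    moreover have "measure \<mu> (R n j) = measure \<mu> UNIV / card J + (1 / Suc n) * (measure N UNIV / card J - measure N (R n j))" for n
      using R(3)[OF j, of n] mM[of "R n j" n] mM[of UNIV n] R(1)[OF j, of n]
      by (simp add: add_divide_distrib algebra_simps)
    ultimately show ?thesis by simp
  qed
  have cover: "(\<Union>j\<in>J. closure (R n j)) = UNIV" for n
  proof -
    interpret Y: yao_yao_measure b "M n" by (rule YM)
    show ?thesis
      using disjoint_open_closure_cover[OF Y.finite_measure_axioms Y.sets_M finJ Jne R(1,4,3) Y.open_pos] by blast
  qed
  show ?thesis
    using equal_partition_limit[OF \<open>finite_measure \<mu>\<close> sets_\<mu> ac pos finJ R(1,2,4) cover lim R(5)]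
    unfolding cardJ by blast
qed

theorem theorem1p3:
  fixes t :: nat and \<mu> :: "(real ^ 'd) measure"
  assumes "t > 0"
    and "sets \<mu> = sets borel"
    and "finite_measure \<mu>"
    and "absolutely_continuous lborel \<mu>"
  shows "\<exists>P :: (real ^ 'd) set set.
           convex_partition P \<and>
           card P = (t + 1) * 2 ^ (CARD('d) - 1) \<and>
           (\<forall>C\<in>P. \<forall>D\<in>P. emeasure \<mu> C = emeasure \<mu> D) \<and>
           (\<forall>H. hyperplane H \<longrightarrow> card {C \<in> P. avoids_interior H C} \<ge> t)"
proof (cases "measure \<mu> UNIV = 0")
  case False
  then have "0 < measure \<mu> UNIV" by (simp add: zero_less_measure_iff)
  from equal_partition_exists[OF assms(3,2,4) this, of t] show ?thesis by simp
next
  case True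
  interpret finite_measure \<mu> by fact
  have zero: "emeasure \<mu> A = 0" for A
    using emeasure_mono[of A UNIV \<mu>] True assms(2) by (cases "A \<in> sets \<mu>") (auto simp: emeasure_eq_measure emeasure_notin_sets)
  obtain b :: "nat \<Rightarrow> real ^ 'd" where b: "coordinate_frame b" using exists_frame by blast
  obtain h :: "real ^ 'd \<Rightarrow> ennreal" where h: "h \<in> borel_measurable borel"
    "integral\<^sup>N lborel h \<noteq> \<infinity>" "\<And>x. 0 < h x"
    using exists_positive_finite_density by blast
  \<comment> \<open>All sets have mass 0 under \<mu>, so the partition may be taken from any nonzero
    auxiliary measure.\<close>
  interpret Y: yao_yao_measure b "density lborel h" by (rule density_positive_measure[OF h b])
  show ?thesis
    using equal_partition_exists[OF Y.finite_measure_axioms Y.sets_M Y.ac Y.measure_UNIV_pos, of t] zero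
    by auto
qed

end
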